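(* Let $1<p<\infty$, $p\neq 2$, and let $\varphi:\mathcal{W}_p(\mathbb{R})\to\mathcal{W}_p(\mathbb{R})$ be an isometric embedding, that is, $d_{\mathcal{W}_p}(\varphi(\mu),\varphi(\nu))=d_{\mathcal{W}_p}(\mu,\nu)$ for all $\mu,\nu\in\mathcal{W}_p(\mathbb{R})$ (surjectivity is not assumed). Then $\varphi$ is a composition of a trivial isometry and a translation, that is, there exist $\psi\in\mathrm{Isom}(\mathbb{R})$ and $\nu\in\mathcal{W}_p(\mathbb{R})$ such that $$F^{-1}_{\varphi(\mu)}=F^{-1}_{\psi_\#(\mu)}+F^{-1}_{\nu}\qquad(\mu\in\mathcal{W}_p(\mathbb{R})).$$ In particular, if $\varphi$ is also bijective, then $\varphi=\psi_\#$ for some $\psi\in\mathrm{Isom}(\mathbb{R})$; therefore $\mathrm{Isom}(\mathbb{R})=\mathrm{Isom}(\mathcal{W}_p(\mathbb{R}))\subsetneq\mathrm{IsEmb}(\mathcal{W}_p(\mathbb{R}))$, where $\mathrm{Isom}(\mathbb{R})$ is identified with a subgroup of $\mathrm{Isom}(\mathcal{W}_p(\mathbb{R}))$ via $\psi\mapsto\psi_\#$.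
   Context: $\mathcal{W}_p(\mathbb{R})$ is the set of Borel probability measures $\mu$ on $\mathbb{R}$ with $\int|x|^p\,d\mu(x)<\infty$, with the $p$-Wasserstein distance $d_{\mathcal{W}_p}(\mu,\nu)=\left(\inf_{\pi}\int |x-y|^p\,d\pi(x,y)\right)^{1/p}$, the infimum being over all couplings $\pi$ of $\mu$ and $\nu$. The quantile function of $\mu$ is $F_\mu^{-1}:(0,1)\to\mathbb{R}$, $F_\mu^{-1}(y)=\sup\{x\in\mathbb{R}\mid \mu((-\infty,x])\le y\}$. $\mathrm{IsEmb}$ denotes the semigroup of distance preserving self-maps (isometric embeddings) of a metric space and $\mathrm{Isom}$ the group of surjective ones (isometries). The push-forward is $(\psi_\#\mu)(A)=\mu(\psi^{-1}[A])$. Isometries of $\mathcal{W}_p(\mathbb{R})$ of the form $\psi_\#$ with $\psi\in\mathrm{Isom}(\mathbb{R})$ are called trivial; the translation by $\nu\in\mathcal{W}_p(\mathbb{R})$ is the map $\mu\mapsto\mu'$ with $F^{-1}_{\mu'}=F^{-1}_\mu+F^{-1}_\nu$. *)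

theory Defs
  imports "HOL-Probability.Probability" "HOL-Algebra.Bij"
begin

definition Wp :: "real \<Rightarrow> real measure set" where
  "Wp p = {\<mu>. real_distribution \<mu> \<and> integrable \<mu> (\<lambda>x. \<bar>x\<bar> powr p)}"

definition couplings :: "real measure \<Rightarrow> real measure \<Rightarrow> (real \<times> real) measure set" where
  "couplings \<mu> \<nu> =
    {\<pi>. prob_space \<pi> \<and> sets \<pi> = sets borel \<and> distr \<pi> borel fst = \<mu> \<and> distr \<pi> borel snd = \<nu>}"

text \<open>The transport cost is a nonnegative integral with values in \<^typ>\<open>ennreal\<close>, so a coupling of
  infinite cost is not assigned cost \<open>0\<close>. On \<^term>\<open>Wp p\<close> with \<open>p \<ge> 1\<close> the infimum is finite, hence
  \<^const>\<open>enn2real\<close> loses nothing there.\<close>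
definition dW :: "real \<Rightarrow> real measure \<Rightarrow> real measure \<Rightarrow> real" where
  "dW p \<mu> \<nu> =
    enn2real (INF \<pi>\<in>couplings \<mu> \<nu>. \<integral>\<^sup>+ z. ennreal (\<bar>fst z - snd z\<bar> powr p) \<partial>\<pi>) powr (1 / p)"

text \<open>Only meaningful for \<open>0 < y < 1\<close>, where the set is nonempty and bounded above.\<close>
definition quantile :: "real measure \<Rightarrow> real \<Rightarrow> real" where
  "quantile \<mu> y = Sup {x. cdf \<mu> x \<le> y}"

text \<open>Distance preserving self-maps of the set \<open>X\<close> with distance \<open>d\<close>. Surjectivity is not required.\<close>
definition isometric_embedding :: "'a set \<Rightarrow> ('a \<Rightarrow> 'a \<Rightarrow> real) \<Rightarrow> ('a \<Rightarrow> 'a) \<Rightarrow> bool" where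
  "isometric_embedding X d f \<longleftrightarrow> f \<in> X \<rightarrow> X \<and> (\<forall>x\<in>X. \<forall>y\<in>X. d (f x) (f y) = d x y)"

text \<open>As in \<^const>\<open>Bij\<close>, maps are taken extensional so that each self-map of \<open>X\<close> is counted once;
  for \<open>X = UNIV\<close> this is no restriction.\<close>
definition IsEmb :: "'a set \<Rightarrow> ('a \<Rightarrow> 'a \<Rightarrow> real) \<Rightarrow> ('a \<Rightarrow> 'a) set" where
  "IsEmb X d = extensional X \<inter> {f. isometric_embedding X d f}"

definition Isom :: "'a set \<Rightarrow> ('a \<Rightarrow> 'a \<Rightarrow> real) \<Rightarrow> ('a \<Rightarrow> 'a) set" where
  "Isom X d = {f \<in> IsEmb X d. f ` X = X}"

definition IsomGroup :: "'a set \<Rightarrow> ('a \<Rightarrow> 'a \<Rightarrow> real) \<Rightarrow> ('a \<Rightarrow> 'a) monoid" where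
  "IsomGroup X d = BijGroup X \<lparr>carrier := Isom X d\<rparr>"

definition push :: "real \<Rightarrow> (real \<Rightarrow> real) \<Rightarrow> real measure \<Rightarrow> real measure" where
  "push p \<psi> = (\<lambda>\<mu>\<in>Wp p. distr \<mu> borel \<psi>)"

end

theory Submission
  imports Defs
begin

text \<open>The quantile map identifies \<open>Wp p\<close> with the cone of nondecreasing functions in
  \<open>L\<^sup>p(0,1)\<close>. Since the norm is strictly convex, an isometric embedding of this cone preserves
  ratios on segments, so after subtracting the image of \<open>0\<close> it is additive, positively homogeneous
  and again maps the cone into itself. Applied to the constants \<open>1\<close> and \<open>-1\<close> this yields
  that \<open>1\<close> is sent to \<open>1\<close> or \<open>-1\<close>, and reflecting the line reduces to the first case. For
  \<open>p \<noteq> 2\<close>, Clarkson's inequality \<open>1 + \<bar>2v - 1\<bar>\<^sup>p \<ge> 2\<bar>v\<bar>\<^sup>p + 2\<bar>1 - v\<bar>\<^sup>p\<close> (reversed for \<open>p < 2\<close>) is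
  an equality only for \<open>v \<in> {0, 1}\<close>; hence indicators of up-sets go to indicators of up-sets of
  the same measure, that is, to themselves. Their positive combinations plus constants are dense,
  so the linear part is the identity.\<close>

section \<open>Convexity inequalities for powers\<close>

text \<open>The map need not be onto and lives on a cone rather than a linear space, so neither the
  Mazur-Ulam theorem nor the Banach-Lamperti description of isometries of L^p applies directly.
  Norms are preserved only for differences of two cone elements, and the Clarkson expression is
  arranged accordingly: for a 0-1 valued nondecreasing \<open>J\<close> both \<open>J\<close> and
  \<open>2 * J - 1\<close> lie in the cone, while \<open>1 - J\<close>, in general decreasing,
  enters as the distance from the constant 1 to \<open>J\<close>. An up-set of the interval is
  determined by its length, which excludes the rearrangements that isometries of L^p usually
  involve. At \<open>p = 2\<close> the deficit vanishes identically, by the parallelogram law, and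
  detects nothing. That quantile functions compute the distance is shown without duality: the cost
  is layered into masses of quadrants, each of which is smallest for the comonotone coupling.
  Right-continuous representatives turn equalities almost everywhere into equalities on the whole
  open interval; the reflection of \<open>y\<close> to \<open>1 - y\<close> destroys right
  continuity, and there the statements hold almost everywhere.\<close>

lemma abs_powr_gt_tangent:
  fixes p s :: real
  assumes "1 < p" and "s \<noteq> 1"
  shows "1 + p * (s - 1) < \<bar>s\<bar> powr p"
proof -
  have der: "\<And>x. 0 < x \<Longrightarrow> ((\<lambda>x. x powr p) has_real_derivative p * x powr (p - 1)) (at x)"
    using has_real_derivative_powr by blast
  consider "s \<le> 0" | "0 < s" "s < 1" | "1 < s"
    using assms(2) by linarith
  then show ?thesis
  proof cases
    \<comment> \<open>The derivative of the power is available only at positive arguments. For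
      \<open>s \<le> 0\<close> the tangent line is already negative, being at most
      \<open>1 - p\<close>.\<close>
    case 1
    then have "1 + p * (s - 1) < 0"
      using assms(1) mult_nonneg_nonpos[of p s] by (simp add: algebra_simps)
    then show ?thesis
      by (smt (verit) powr_ge_zero)
  next
    case 2
    obtain z where z: "s < z" "z < 1" "1 powr p - s powr p = (1 - s) * (p * z powr (p - 1))"
      using MVT2[OF 2(2), of "\<lambda>x. x powr p" "\<lambda>x. p * x powr (p - 1)"] der 2(1) by auto
    have "z powr (p - 1) < 1"
      using z 2(1) assms(1) powr_less_mono2[of "p - 1" z 1] by simp
    then have "(1 - s) * p * z powr (p - 1) < (1 - s) * p * 1"
      using 2 assms(1) by (intro mult_strict_left_mono) auto
    then show ?thesis
      using z(3) 2 by (simp add: algebra_simps)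
  next
    case 3
    obtain z where z: "1 < z" "z < s" "s powr p - 1 powr p = (s - 1) * (p * z powr (p - 1))"
      using MVT2[OF 3, of "\<lambda>x. x powr p" "\<lambda>x. p * x powr (p - 1)"] der by auto
    have "1 < z powr (p - 1)"
      using z assms(1) powr_less_mono2[of "p - 1" 1 z] by simp
    then have "(s - 1) * p * 1 < (s - 1) * p * z powr (p - 1)"
      using 3 assms(1) by (intro mult_strict_left_mono) auto
    then show ?thesis
      using z(3) 3 by (simp add: algebra_simps)
  qed
qed

text \<open>Division by the mean \<open>w\<close> moves it to 1, where the tangent inequality is
  strict at \<open>u / w\<close> and \<open>v / w\<close>; the linear terms cancel in the weighted
  sum. A vanishing mean cannot be normalised and makes the left side 0.\<close>

lemma abs_powr_strict_convex:
  fixes p t u v :: real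
  assumes "1 < p" "0 < t" "t < 1" "u \<noteq> v"
  shows "\<bar>t * u + (1 - t) * v\<bar> powr p < t * \<bar>u\<bar> powr p + (1 - t) * \<bar>v\<bar> powr p"
proof -
  define w where "w = t * u + (1 - t) * v"
  show ?thesis
  proof (cases "w = 0")
    case True
    have "u \<noteq> 0 \<or> v \<noteq> 0" using assms by auto
    then have "0 < t * \<bar>u\<bar> powr p + (1 - t) * \<bar>v\<bar> powr p"
      using assms by (smt (verit) mult_pos_pos powr_ge_zero powr_gt_zero mult_nonneg_nonneg)
    then show ?thesis using True w_def by simp
  next
    case False
    have "w - u = (1 - t) * (v - u)" "w - v = t * (u - v)"
      by (simp_all add: w_def algebra_simps)
    then have "u \<noteq> w" "v \<noteq> w"
      using assms by auto
    then have less: "1 + p * (u / w - 1) < \<bar>u / w\<bar> powr p" "1 + p * (v / w - 1) < \<bar>v / w\<bar> powr p"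
      using False abs_powr_gt_tangent[OF assms(1), of "u / w"] abs_powr_gt_tangent[OF assms(1), of "v / w"]
      by auto
    have "t * (u / w) + (1 - t) * (v / w) = 1"
      using False by (simp add: w_def add_divide_distrib[symmetric])
    then have "1 = t * (1 + p * (u / w - 1)) + (1 - t) * (1 + p * (v / w - 1))"
      by algebra
    also have "\<dots> < t * \<bar>u / w\<bar> powr p + (1 - t) * \<bar>v / w\<bar> powr p"
      using less assms by (intro add_strict_mono mult_strict_left_mono) auto
    finally have "\<bar>w\<bar> powr p * 1 < \<bar>w\<bar> powr p * (t * \<bar>u / w\<bar> powr p + (1 - t) * \<bar>v / w\<bar> powr p)"
      using False by (intro mult_strict_left_mono) auto
    also have "\<dots> = t * \<bar>u\<bar> powr p + (1 - t) * \<bar>v\<bar> powr p"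
      using False by (simp add: powr_divide field_simps)
    finally show ?thesis
      by (simp add: w_def)
  qed
qed

text \<open>A substitute for Minkowski's inequality where only integrability or convergence to 0
  matters; the constant comes from bounding the sum by twice the maximum.\<close>

lemma abs_powr_add_le:
  fixes p a b :: real
  assumes "0 \<le> p"
  shows "\<bar>a + b\<bar> powr p \<le> 2 powr p * (\<bar>a\<bar> powr p + \<bar>b\<bar> powr p)"
proof -
  have "\<bar>a + b\<bar> powr p \<le> (2 * max \<bar>a\<bar> \<bar>b\<bar>) powr p"
    using assms by (intro powr_mono2) auto
  also have "\<dots> = 2 powr p * max \<bar>a\<bar> \<bar>b\<bar> powr p"
    by (simp add: powr_mult)
  also have "\<dots> \<le> 2 powr p * (\<bar>a\<bar> powr p + \<bar>b\<bar> powr p)"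
    by (intro mult_left_mono) (auto simp: max_def)
  finally show ?thesis .
qed

text \<open>After normalising the sum to 1 this is \<open>z powr q \<le> z\<close> on the unit
  interval, added up for the two shares.\<close>

lemma powr_superadditive:
  fixes q x y :: real
  assumes "1 < q" "0 \<le> x" "0 \<le> y"
  shows "x powr q + y powr q \<le> (x + y) powr q"
proof (cases "x + y = 0")
  case False
  define s where "s = x + y"
  have s: "0 < s" using False assms s_def by auto
  have le: "(z / s) powr q \<le> z / s" if "0 \<le> z" "z \<le> s" for z
    using powr_mono'[of 1 q "z / s"] that s assms(1) by simp
  have "(x / s) powr q + (y / s) powr q \<le> x / s + y / s"
    using assms by (intro add_mono le) (auto simp: s_def)
  also have "\<dots> = 1" using s by (simp add: s_def add_divide_distrib[symmetric])
  finally have "(x powr q + y powr q) / s powr q \<le> 1"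
    using s assms by (simp add: powr_divide add_divide_distrib)
  then show ?thesis using s by (simp add: s_def)
next
  case True
  then have "x = 0" "y = 0" using assms by auto
  then show ?thesis by simp
qed

text \<open>Superadditivity for the exponent \<open>1 / q\<close>, applied to the
  \<open>q\<close>-th powers of \<open>x\<close> and \<open>y\<close>.\<close>

lemma powr_subadditive:
  fixes q x y :: real
  assumes "0 < q" "q < 1" "0 \<le> x" "0 \<le> y"
  shows "(x + y) powr q \<le> x powr q + y powr q"
proof -
  have "(x + y) powr q = ((x powr q) powr (1 / q) + (y powr q) powr (1 / q)) powr q"
    using assms by (simp add: powr_powr)
  also have "\<dots> \<le> ((x powr q + y powr q) powr (1 / q)) powr q"
    using assms by (intro powr_mono2 powr_superadditive) auto
  finally show ?thesis
    using assms by (simp add: powr_powr)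
qed

lemma powr_midpoint_convex_strict:
  fixes q A B :: real
  assumes "1 < q" "0 \<le> A - B" "0 \<le> A + B" "B \<noteq> 0"
  shows "2 * A powr q < (A + B) powr q + (A - B) powr q"
proof -
  have "A = (1/2) * (A + B) + (1 - 1/2) * (A - B)" by (simp add: field_simps)
  moreover have "0 \<le> A" using assms by auto
  ultimately show ?thesis
    using abs_powr_strict_convex[of q "1/2" "A + B" "A - B"] assms by (simp add: field_simps)
qed

text \<open>Concavity is obtained from strict convexity of the inverse power \<open>1 / q\<close>,
  evaluated at the \<open>q\<close>-th powers \<open>u\<close> and \<open>v\<close>.\<close>

lemma powr_midpoint_concave_strict:
  fixes q A B :: real
  assumes "0 < q" "q < 1" "0 \<le> A - B" "0 \<le> A + B" "B \<noteq> 0"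
  shows "(A + B) powr q + (A - B) powr q < 2 * A powr q"
proof -
  define u v where "u = (A + B) powr q" and "v = (A - B) powr q"
  have inv: "u powr (1/q) = A + B" "v powr (1/q) = A - B"
    using assms by (auto simp: u_def v_def powr_powr)
  then have "u \<noteq> v" using assms by auto
  then have "\<bar>(1/2) * u + (1 - 1/2) * v\<bar> powr (1/q) < (1/2) * \<bar>u\<bar> powr (1/q) + (1 - 1/2) * \<bar>v\<bar> powr (1/q)"
    using assms by (intro abs_powr_strict_convex) auto
  moreover have "\<bar>u\<bar> = u" "\<bar>v\<bar> = v" by (auto simp: u_def v_def)
  ultimately have "((u + v) / 2) powr (1/q) < A"
    using inv by (simp add: field_simps abs_of_nonneg)
  then have "(((u + v) / 2) powr (1/q)) powr q < A powr q"
    using assms by (intro powr_less_mono2) auto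
  then show ?thesis
    using assms by (simp add: powr_powr u_def v_def)
qed

text \<open>The scalar form of Lamperti's observation that the deficit in Clarkson's inequality
  detects disjoint supports.\<close>
definition clarkson_deficit :: "real \<Rightarrow> real \<Rightarrow> real" where
  "clarkson_deficit p v = 1 + \<bar>2 * v - 1\<bar> powr p - 2 * \<bar>v\<bar> powr p - 2 * \<bar>1 - v\<bar> powr p"

text \<open>With squares as base and exponent \<open>p / 2\<close>, the terms 1 and
  \<open>2 * v - 1\<close> become \<open>A + B\<close> and \<open>A - B\<close>. The quantity
  \<open>2 * A powr (p / 2)\<close> separates the two halves of the deficit: midpoint convexity
  bounds it on one side, superadditivity on the other. Both inequalities turn around when
  \<open>p / 2\<close> drops below 1, and strictness comes from \<open>B \<noteq> 0\<close>.\<close>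

lemma clarkson_deficit_cases:
  fixes p v :: real
  assumes "1 < p"
  shows "v = 0 \<or> v = 1 \<Longrightarrow> clarkson_deficit p v = 0"
    and "p > 2 \<Longrightarrow> v \<noteq> 0 \<Longrightarrow> v \<noteq> 1 \<Longrightarrow> 0 < clarkson_deficit p v"
    and "p < 2 \<Longrightarrow> v \<noteq> 0 \<Longrightarrow> v \<noteq> 1 \<Longrightarrow> clarkson_deficit p v < 0"
proof -
  define A B where "A = v\<^sup>2 + (1 - v)\<^sup>2" and "B = 2 * v * (1 - v)"
  have sq: "\<bar>x\<bar> powr p = (x\<^sup>2) powr (p / 2)" for x :: real
  proof -
    have "(x\<^sup>2) powr (p / 2) = (\<bar>x\<bar> powr 2) powr (p / 2)"
      by (cases "x = 0") (auto simp: powr_numeral)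
    then show ?thesis by (simp only: powr_powr) simp
  qed
  have AB: "A + B = 1" "A - B = (2 * v - 1)\<^sup>2"
    by (simp_all add: A_def B_def power2_eq_square algebra_simps)
  have eq: "clarkson_deficit p v = ((A + B) powr (p/2) + (A - B) powr (p/2))
      - 2 * ((v\<^sup>2) powr (p/2) + ((1 - v)\<^sup>2) powr (p/2))"
    by (simp add: clarkson_deficit_def sq AB)
  show "v = 0 \<or> v = 1 \<Longrightarrow> clarkson_deficit p v = 0"
    by (auto simp: clarkson_deficit_def)
  have nn: "0 \<le> A + B" "0 \<le> A - B" by (auto simp: AB)
  show "0 < clarkson_deficit p v" if "p > 2" "v \<noteq> 0" "v \<noteq> 1"
  proof -
    have "B \<noteq> 0" using that by (simp add: B_def)
    then show ?thesis
      using powr_superadditive[of "p/2" "v\<^sup>2" "(1-v)\<^sup>2"] powr_midpoint_convex_strict[of "p/2" A B] nn that(1)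
      unfolding eq by (simp add: A_def)
  qed
  show "clarkson_deficit p v < 0" if "p < 2" "v \<noteq> 0" "v \<noteq> 1"
  proof -
    have "B \<noteq> 0" using that by (simp add: B_def)
    then show ?thesis
      using powr_subadditive[of "p/2" "v\<^sup>2" "(1-v)\<^sup>2"] powr_midpoint_concave_strict[of "p/2" A B] nn that(1) assms
      unfolding eq by (simp add: A_def)
  qed
qed

section \<open>Quantile functions on the unit interval\<close>

definition uniform01 :: "real measure" where
  "uniform01 = restrict_space lborel {0<..<1}"

lemma space_uniform01 [simp]: "space uniform01 = {0<..<1}"
  by (simp add: uniform01_def)

lemma sets_uniform01 [measurable_cong]: "sets uniform01 = sets (restrict_space borel {0<..<1})"
  unfolding uniform01_def by (intro sets_restrict_space_cong) simp

interpretation uniform01: prob_space uniform01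
  by (rule prob_spaceI) (simp add: uniform01_def emeasure_restrict_space space_restrict_space)

lemma measure_uniform01:
  "A \<subseteq> {0<..<1} \<Longrightarrow> measure uniform01 A = measure lborel A"
  unfolding uniform01_def by (subst measure_restrict_space) auto

lemma sets_uniform01I: "A \<in> sets borel \<Longrightarrow> A \<subseteq> {0<..<1} \<Longrightarrow> A \<in> sets uniform01"
  unfolding uniform01_def by (subst sets_restrict_space_iff) auto

lemma AE_uniform01: "(AE y in uniform01. P y) \<longleftrightarrow> (AE y in lborel. y \<in> {0<..<1} \<longrightarrow> P y)"
  unfolding uniform01_def by (subst AE_restrict_space_iff) auto

lemma measurable_uniform01_mono_on:
  fixes f :: "real \<Rightarrow> real"
  shows "mono_on {0<..<1} f \<Longrightarrow> f \<in> borel_measurable uniform01"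
  using borel_measurable_mono_on_fnc measurable_cong_sets[OF sets_uniform01 refl] by blast

text \<open>Selects one representative per class of functions equal almost everywhere. Continuity
  from the right is the side dictated by the supremum in \<open>quantile\<close>.\<close>

definition right_continuous01 :: "(real \<Rightarrow> real) \<Rightarrow> bool" where
  "right_continuous01 f \<longleftrightarrow> (\<forall>y\<in>{0<..<1}. continuous (at_right y) f)"

lemma right_continuous01_const [simp]: "right_continuous01 (\<lambda>_. c)"
  by (simp add: right_continuous01_def)

lemma right_continuous01_add:
  "right_continuous01 f \<Longrightarrow> right_continuous01 g \<Longrightarrow> right_continuous01 (\<lambda>y. f y + g y)"
  by (auto simp: right_continuous01_def intro: continuous_add)

lemma right_continuous01_diff:
  "right_continuous01 f \<Longrightarrow> right_continuous01 g \<Longrightarrow> right_continuous01 (\<lambda>y. f y - g y)"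
  by (auto simp: right_continuous01_def intro: continuous_diff)

lemma right_continuous01_mult:
  "right_continuous01 f \<Longrightarrow> right_continuous01 g \<Longrightarrow> right_continuous01 (\<lambda>y. f y * g y)"
  by (auto simp: right_continuous01_def intro: continuous_mult)

text \<open>A difference that is nonzero at \<open>y\<close> stays nonzero on an interval to the
  right of \<open>y\<close>, and this interval has positive length.\<close>

lemma right_continuous01_AE_eq:
  assumes "right_continuous01 f" "right_continuous01 g"
    and "AE y in uniform01. f y = g y" and y: "y \<in> {0<..<1}"
  shows "f y = g y"
proof (rule ccontr)
  assume "f y \<noteq> g y"
  moreover have "((\<lambda>z. f z - g z) \<longlongrightarrow> f y - g y) (at_right y)"
    using right_continuous01_diff[OF assms(1,2)] y
    by (auto simp: right_continuous01_def continuous_within)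
  ultimately have "eventually (\<lambda>z. f z - g z \<noteq> 0) (at_right y)"
    by (intro tendsto_imp_eventually_ne) auto
  then obtain b where b: "b > y" "\<And>z. y < z \<Longrightarrow> z < b \<Longrightarrow> f z \<noteq> g z"
    unfolding eventually_at_right_field by auto
  \<comment> \<open>The cut at 1 keeps the interval inside the domain of
    \<open>uniform01\<close>.\<close>
  define c where "c = min b 1"
  have c: "y < c" using b y by (auto simp: c_def)
  have "AE z in lborel. z \<notin> {y<..<c}"
    using assms(3) unfolding AE_uniform01 by eventually_elim (use b y in \<open>auto simp: c_def\<close>)
  moreover have "{z \<in> space lborel. \<not> z \<notin> {y<..<c}} = {y<..<c}"
    by auto
  ultimately have "emeasure lborel {y<..<c} = 0"
    by (subst (asm) AE_iff_measurable) auto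
  then show False using c by simp
qed

section \<open>Quantiles as generalised inverses of distribution functions\<close>

context real_distribution
begin

lemma
  assumes "0 < y" "y < 1"
  shows quantile_set_nonempty: "{x. cdf M x \<le> y} \<noteq> {}"
    and quantile_set_bdd_above: "bdd_above {x. cdf M x \<le> y}"
proof -
  have "eventually (\<lambda>x. cdf M x < y) at_bot"
    using cdf_lim_at_bot assms(1) by (rule order_tendstoD)
  then obtain x where "cdf M x < y"
    by (auto simp: eventually_at_bot_linorder)
  then show "{x. cdf M x \<le> y} \<noteq> {}"
    by (auto intro: less_imp_le)
  have "eventually (\<lambda>x. cdf M x > y) at_top"
    using cdf_lim_at_top_prob assms(2) by (rule order_tendstoD)
  then obtain z where "\<And>x. x \<ge> z \<Longrightarrow> cdf M x > y"
    by (auto simp: eventually_at_top_linorder)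
  then show "bdd_above {x. cdf M x \<le> y}"
    by (intro bdd_aboveI[of _ z]) (metis linorder_not_less mem_Collect_eq nle_le)
qed

text \<open>The inequality \<open>y < cdf M s\<close> has to be strict: at
  \<open>y = cdf M s\<close> the quantile sits at the right end of a flat piece of the distribution
  function, possibly beyond \<open>s\<close>.\<close>

lemma quantile_le: "0 < y \<Longrightarrow> y < cdf M s \<Longrightarrow> quantile M y \<le> s"
  unfolding quantile_def
proof (rule cSup_least)
  assume y: "0 < y" "y < cdf M s"
  then show "{x. cdf M x \<le> y} \<noteq> {}"
    using cdf_bounded_prob[of s] by (intro quantile_set_nonempty) auto
  fix x assume "x \<in> {x. cdf M x \<le> y}"
  then show "x \<le> s"
    using y cdf_nondecreasing[of s x] by (cases "x \<le> s") auto
qed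

lemma quantile_ge: "0 < y \<Longrightarrow> y < 1 \<Longrightarrow> cdf M s \<le> y \<Longrightarrow> s \<le> quantile M y"
  unfolding quantile_def by (intro cSup_upper quantile_set_bdd_above) auto

lemma less_cdf: "0 < y \<Longrightarrow> y < 1 \<Longrightarrow> quantile M y < s \<Longrightarrow> y < cdf M s"
  using quantile_ge[of y s] by linarith

lemma mono_on_quantile: "mono_on {0<..<1} (quantile M)"
proof (rule mono_onI)
  fix y z :: real assume yz: "y \<in> {0<..<1}" "z \<in> {0<..<1}" "y \<le> z"
  then show "quantile M y \<le> quantile M z"
    unfolding quantile_def
    by (intro cSup_subset_mono quantile_set_nonempty quantile_set_bdd_above) auto
qed

lemma right_continuous01_quantile: "right_continuous01 (quantile M)"
  unfolding right_continuous01_def continuous_within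
proof
  fix y :: real assume y: "y \<in> {0<..<1}"
  show "(quantile M \<longlongrightarrow> quantile M y) (at_right y)"
  proof (rule order_tendstoI)
    fix a assume "a < quantile M y"
    moreover have "eventually (\<lambda>z. z \<in> {y<..<1}) (at_right y)"
      using y by (intro eventually_at_rightI) auto
    ultimately show "eventually (\<lambda>z. a < quantile M z) (at_right y)"
      using mono_onD[OF mono_on_quantile, of y] y
      by (elim eventually_mono) (fastforce intro: less_le_trans)
  next
    fix a assume a: "quantile M y < a"
    \<comment> \<open>The gap between \<open>y\<close> and \<open>cdf M s\<close> is a right
      neighbourhood of \<open>y\<close> on which quantiles do not exceed \<open>s\<close>.\<close>
    then obtain s where s: "quantile M y < s" "s < a" using dense by blast
    then have "y < cdf M s" using y by (intro less_cdf) auto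
    then have "eventually (\<lambda>z. z \<in> {y<..<cdf M s}) (at_right y)"
      by (intro eventually_at_rightI) auto
    then show "eventually (\<lambda>z. quantile M z < a) (at_right y)"
      by eventually_elim (use y in \<open>auto intro!: le_less_trans[OF quantile_le s(2)]\<close>)
  qed
qed

text \<open>Inverse transform sampling: up to the point \<open>cdf M s\<close>, the sublevel set of
  the quantile at height \<open>s\<close> is the interval from 0 to \<open>cdf M s\<close>.\<close>

lemma distr_quantile: "distr uniform01 borel (quantile M) = M"
proof (rule cdf_unique)
  have meas[measurable]: "quantile M \<in> borel_measurable uniform01"
    by (rule measurable_uniform01_mono_on[OF mono_on_quantile])
  show "real_distribution (distr uniform01 borel (quantile M))"
    using uniform01.prob_space_distr[OF meas] by (simp add: real_distribution_def real_distribution_axioms_def)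
  show "real_distribution M" ..
  show "cdf (distr uniform01 borel (quantile M)) = cdf M"
  proof
    fix s
    let ?A = "{y\<in>{0<..<1}. quantile M y \<le> s}"
    have "cdf (distr uniform01 borel (quantile M)) s = measure uniform01 (quantile M -` {..s} \<inter> space uniform01)"
      unfolding cdf_def by (subst measure_distr) auto
    also have "quantile M -` {..s} \<inter> space uniform01 = ?A" by auto
    finally have eq: "cdf (distr uniform01 borel (quantile M)) s = measure uniform01 ?A" .
    have A: "?A \<in> sets uniform01"
      using measurable_sets[OF meas, of "{..s}"] by (simp add: vimage_def Int_def conj_commute)
    have F: "0 \<le> cdf M s" "cdf M s \<le> 1" by (auto simp: cdf_nonneg cdf_bounded_prob)
    have "measure uniform01 {0<..<cdf M s} \<le> measure uniform01 ?A"
      using F A by (intro uniform01.finite_measure_mono) (auto intro!: quantile_le)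
    moreover have "measure uniform01 {0<..<cdf M s} = cdf M s"
      using F by (subst measure_uniform01) auto
    \<comment> \<open>If \<open>cdf M s < y\<close>, right continuity provides some
      \<open>x > s\<close> with \<open>cdf M x < y\<close>, and then the quantile at
      \<open>y\<close> is at least \<open>x\<close>.\<close>
    moreover have "?A \<subseteq> {0<..<1} \<inter> {0<..cdf M s}"
    proof
      fix y assume y: "y \<in> ?A"
      have "y \<le> cdf M s"
      proof (rule ccontr)
        assume "\<not> y \<le> cdf M s"
        then have "eventually (\<lambda>x. cdf M x < y) (at_right s)"
          using cdf_is_right_cont[of s] by (auto simp: continuous_within intro: order_tendstoD)
        then obtain b where "b > s" "\<And>x. s < x \<Longrightarrow> x < b \<Longrightarrow> cdf M x < y"
          unfolding eventually_at_right_field by auto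
        moreover from this(1) obtain x where "s < x" "x < b" using dense by blast
        ultimately have "cdf M x \<le> y" "s < x" by (auto intro: less_imp_le)
        then show False using quantile_ge[of y x] y by auto
      qed
      then show "y \<in> {0<..<1} \<inter> {0<..cdf M s}" using y by auto
    qed
    then have "measure uniform01 ?A \<le> measure uniform01 ({0<..<1} \<inter> {0<..cdf M s})"
      by (intro uniform01.finite_measure_mono sets_uniform01I) auto
    moreover have "measure uniform01 ({0<..<1} \<inter> {0<..cdf M s}) \<le> cdf M s"
    proof -
      have "measure uniform01 ({0<..<1} \<inter> {0<..cdf M s}) = measure lborel ({0<..<1} \<inter> {0<..cdf M s})"
        by (rule measure_uniform01) auto
      also have "\<dots> \<le> measure lborel {0<..cdf M s}"
        using F by (intro measure_mono_fmeasurable) (auto simp: fmeasurable_def)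
      finally show ?thesis using F by simp
    qed
    ultimately show "cdf (distr uniform01 borel (quantile M)) s = cdf M s"
      using eq by linarith
  qed
qed

end

lemma real_distribution_distr_uniform01:
  "f \<in> borel_measurable uniform01 \<Longrightarrow> real_distribution (distr uniform01 borel f)"
  using uniform01.prob_space_distr[of f borel]
  by (simp add: real_distribution_def real_distribution_axioms_def)

section \<open>Optimal transport on the line\<close>

lemma nn_integral_powr_diff:
  fixes p x y :: real
  assumes "1 < p" "x \<le> y"
  shows "(\<integral>\<^sup>+s. ennreal (indicator {x..y} s * (p * (y - s) powr (p - 1))) \<partial>lborel) = ennreal ((y - x) powr p)"
proof (rule nn_integral_has_integral_lborel)
  have "((\<lambda>s. p * (y - s) powr (p - 1)) has_integral (- ((y - y) powr p) - - ((y - x) powr p))) {x..y}"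
  proof (rule fundamental_theorem_of_calculus_interior_strong[of "{}"])
    show "continuous_on {x..y} (\<lambda>s. - ((y - s) powr p))"
      using assms by (intro continuous_intros continuous_on_powr') auto
    have der: "((\<lambda>s. - ((y - s) powr p)) has_real_derivative p * (y - s) powr (p - 1)) (at s)" if "s \<in> {x<..<y}" for s
      using that by (auto intro!: derivative_eq_intros)
    show "((\<lambda>s. - ((y - s) powr p)) has_vector_derivative p * (y - s) powr (p - 1)) (at s)" if "s \<in> {x<..<y} - {}" for s
      using der[of s] that by (simp add: has_real_derivative_iff_has_vector_derivative)
  qed (use assms in auto)
  then have "((\<lambda>s. if s \<in> {x..y} then p * (y - s) powr (p - 1) else 0) has_integral ((y - x) powr p)) UNIV"
    by (subst has_integral_restrict_UNIV) simp
  moreover have "(\<lambda>s. if s \<in> {x..y} then p * (y - s) powr (p - 1) else 0)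
      = (\<lambda>s. indicator {x..y} s * (p * (y - s) powr (p - 1)))"
    by (auto simp: indicator_def)
  ultimately show "((\<lambda>s. indicator {x..y} s * (p * (y - s) powr (p - 1))) has_integral ((y - x) powr p)) UNIV"
    by simp
qed (use assms in auto)

text \<open>Layer-cake representation of the cost: it reduces the transport problem to the events
  \<open>X \<le> a \<and> b \<le> Y\<close>.\<close>
lemma powr_pos_part_layer_cake:
  fixes p x y :: real
  assumes "1 < p"
  shows "ennreal p * (\<integral>\<^sup>+s. \<integral>\<^sup>+r. indicator {(x, y). 0 < r \<and> x \<le> s \<and> s + r powr (1 / (p - 1)) \<le> y} (x, y) \<partial>lborel \<partial>lborel)
    = ennreal (max 0 (y - x) powr p)"
proof -
  have inner: "(\<integral>\<^sup>+r. indicator {(x, y). 0 < r \<and> x \<le> s \<and> s + r powr (1 / (p - 1)) \<le> y} (x, y) \<partial>lborel)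
      = ennreal (indicator {x..y} s * (y - s) powr (p - 1))" for s
  proof -
    \<comment> \<open>Solving the height condition for \<open>y\<close> instead of \<open>r\<close>
      makes it, for fixed \<open>s\<close> and \<open>r\<close>, a threshold on \<open>y\<close>
      alone.\<close>
    have "r powr (1 / (p - 1)) \<le> y - s \<longleftrightarrow> r \<le> (y - s) powr (p - 1)" if "0 < r" "s \<le> y" for r
    proof
      assume "r powr (1 / (p - 1)) \<le> y - s"
      then have "(r powr (1 / (p - 1))) powr (p - 1) \<le> (y - s) powr (p - 1)"
        using assms by (intro powr_mono2) auto
      then show "r \<le> (y - s) powr (p - 1)" using assms that by (simp add: powr_powr)
    next
      assume "r \<le> (y - s) powr (p - 1)"
      then have "r powr (1 / (p - 1)) \<le> ((y - s) powr (p - 1)) powr (1 / (p - 1))"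
        using assms that by (intro powr_mono2) auto
      then show "r powr (1 / (p - 1)) \<le> y - s" using assms that by (simp add: powr_powr)
    qed
    moreover have "s \<le> y" if "s + r powr (1 / (p - 1)) \<le> y" for r
      using that powr_ge_zero[of r "1 / (p - 1)"] by linarith
    ultimately have "0 < r \<and> x \<le> s \<and> s + r powr (1 / (p - 1)) \<le> y \<longleftrightarrow>
        s \<in> {x..y} \<and> r \<in> {0<..(y - s) powr (p - 1)}" for r
      by (auto simp: le_diff_eq add.commute)
    then have "(\<integral>\<^sup>+r. indicator {(x, y). 0 < r \<and> x \<le> s \<and> s + r powr (1 / (p - 1)) \<le> y} (x, y) \<partial>lborel)
      = (\<integral>\<^sup>+r. indicator {x..y} s * indicator {0<..(y - s) powr (p - 1)} r \<partial>lborel)"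
      by (intro nn_integral_cong) (auto simp: indicator_def)
    also have "\<dots> = ennreal (indicator {x..y} s * (y - s) powr (p - 1))"
      by (subst nn_integral_cmult) (auto simp: indicator_def)
    finally show ?thesis .
  qed
  have "ennreal p * (\<integral>\<^sup>+s. \<integral>\<^sup>+r. indicator {(x, y). 0 < r \<and> x \<le> s \<and> s + r powr (1 / (p - 1)) \<le> y} (x, y) \<partial>lborel \<partial>lborel)
      = (\<integral>\<^sup>+s. ennreal p * ennreal (indicator {x..y} s * (y - s) powr (p - 1)) \<partial>lborel)"
    unfolding inner by (subst nn_integral_cmult) auto
  also have "\<dots> = (\<integral>\<^sup>+s. ennreal (indicator {x..y} s * (p * (y - s) powr (p - 1))) \<partial>lborel)"
    using assms by (intro nn_integral_cong) (simp add: ennreal_mult'[symmetric] mult_ac)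
  also have "\<dots> = ennreal (max 0 (y - x) powr p)"
  proof (cases "x \<le> y")
    case True
    then show ?thesis using nn_integral_powr_diff[OF assms True] by simp
  next
    case False
    then show ?thesis by simp
  qed
  finally show ?thesis .
qed

text \<open>Tonelli's theorem moves the integral over \<open>M\<close> inside the two layer
  parameters, where it meets an indicator and becomes the mass of a quadrant.\<close>

lemma nn_integral_powr_pos_part:
  fixes p :: real and X Y :: "'a \<Rightarrow> real"
  assumes "1 < p" "sigma_finite_measure M" and [measurable]: "X \<in> borel_measurable M" "Y \<in> borel_measurable M"
  shows "(\<integral>\<^sup>+\<omega>. ennreal (max 0 (Y \<omega> - X \<omega>) powr p) \<partial>M) =
    ennreal p * (\<integral>\<^sup>+s. \<integral>\<^sup>+r. indicator {0<..} r *
      emeasure M {\<omega> \<in> space M. X \<omega> \<le> s \<and> s + r powr (1 / (p - 1)) \<le> Y \<omega>} \<partial>lborel \<partial>lborel)"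
proof -
  interpret sigma_finite_measure M by fact
  interpret pair_sigma_finite M "lborel :: real measure" ..
  define f :: "'a \<Rightarrow> real \<Rightarrow> real \<Rightarrow> ennreal" where
    "f \<omega> s r = indicator {(x, y). 0 < r \<and> x \<le> s \<and> s + r powr (1 / (p - 1)) \<le> y} (X \<omega>, Y \<omega>)" for \<omega> s r
  have f_alt: "f \<omega> s r = (if 0 < r \<and> X \<omega> \<le> s \<and> s + r powr (1 / (p - 1)) \<le> Y \<omega> then 1 else 0)" for \<omega> s r
    by (simp add: f_def indicator_def)
  have meas3[measurable]: "(\<lambda>(z, r). f (fst z) (snd z) r) \<in> borel_measurable ((M \<Otimes>\<^sub>M lborel) \<Otimes>\<^sub>M lborel)"
    unfolding f_alt by measurable
  have meas2: "(\<lambda>(\<omega>, s). \<integral>\<^sup>+r. f \<omega> s r \<partial>lborel) \<in> borel_measurable (M \<Otimes>\<^sub>M lborel)"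
    using lborel.borel_measurable_nn_integral[OF meas3] by (simp add: case_prod_beta)
  have meas2': "(\<lambda>(\<omega>, r). f \<omega> s r) \<in> borel_measurable (M \<Otimes>\<^sub>M lborel)" for s
    unfolding f_alt by measurable
  have "(\<integral>\<^sup>+\<omega>. ennreal (max 0 (Y \<omega> - X \<omega>) powr p) \<partial>M) =
      (\<integral>\<^sup>+\<omega>. ennreal p * (\<integral>\<^sup>+s. \<integral>\<^sup>+r. f \<omega> s r \<partial>lborel \<partial>lborel) \<partial>M)"
    unfolding f_def powr_pos_part_layer_cake[OF assms(1)] ..
  also have "\<dots> = ennreal p * (\<integral>\<^sup>+\<omega>. (\<integral>\<^sup>+s. \<integral>\<^sup>+r. f \<omega> s r \<partial>lborel \<partial>lborel) \<partial>M)"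
    using lborel.borel_measurable_nn_integral[OF meas2] by (intro nn_integral_cmult) simp
  also have "(\<integral>\<^sup>+\<omega>. (\<integral>\<^sup>+s. \<integral>\<^sup>+r. f \<omega> s r \<partial>lborel \<partial>lborel) \<partial>M) =
      (\<integral>\<^sup>+s. \<integral>\<^sup>+\<omega>. \<integral>\<^sup>+r. f \<omega> s r \<partial>lborel \<partial>M \<partial>lborel)"
    using Fubini'[OF meas2] by simp
  also have "\<dots> = (\<integral>\<^sup>+s. \<integral>\<^sup>+r. \<integral>\<^sup>+\<omega>. f \<omega> s r \<partial>M \<partial>lborel \<partial>lborel)"
    using Fubini'[OF meas2'] by simp
  finally have eq: "(\<integral>\<^sup>+\<omega>. ennreal (max 0 (Y \<omega> - X \<omega>) powr p) \<partial>M) =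
      ennreal p * (\<integral>\<^sup>+s. \<integral>\<^sup>+r. \<integral>\<^sup>+\<omega>. f \<omega> s r \<partial>M \<partial>lborel \<partial>lborel)" .
  have "(\<integral>\<^sup>+\<omega>. f \<omega> s r \<partial>M) = indicator {0<..} r *
      emeasure M {\<omega> \<in> space M. X \<omega> \<le> s \<and> s + r powr (1 / (p - 1)) \<le> Y \<omega>}" for s r
  proof -
    have "(\<integral>\<^sup>+\<omega>. f \<omega> s r \<partial>M) = (\<integral>\<^sup>+\<omega>. indicator {0<..} r *
      indicator {\<omega> \<in> space M. X \<omega> \<le> s \<and> s + r powr (1 / (p - 1)) \<le> Y \<omega>} \<omega> \<partial>M)"
      by (intro nn_integral_cong) (auto simp: f_def indicator_def)
    then show ?thesis by (simp add: nn_integral_cmult)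
  qed
  then show ?thesis by (simp add: eq)
qed

text \<open>The layer-cake formula sees the joint law of \<open>X\<close> and \<open>Y\<close> only
  through the masses of the quadrants \<open>X \<le> a\<close>, \<open>b \<le> Y\<close>, and is
  monotone in them. This allows random variables on different spaces to be compared.\<close>

lemma nn_integral_powr_pos_part_mono:
  fixes p :: real and X Y :: "'a \<Rightarrow> real" and X' Y' :: "'b \<Rightarrow> real"
  assumes "1 < p" "sigma_finite_measure M" "sigma_finite_measure N"
    and "X \<in> borel_measurable M" "Y \<in> borel_measurable M"
    and "X' \<in> borel_measurable N" "Y' \<in> borel_measurable N"
    and "\<And>a b. emeasure M {\<omega>\<in>space M. X \<omega> \<le> a \<and> b \<le> Y \<omega>} \<le> emeasure N {\<omega>\<in>space N. X' \<omega> \<le> a \<and> b \<le> Y' \<omega>}"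
  shows "(\<integral>\<^sup>+\<omega>. ennreal (max 0 (Y \<omega> - X \<omega>) powr p) \<partial>M) \<le> (\<integral>\<^sup>+\<omega>. ennreal (max 0 (Y' \<omega> - X' \<omega>) powr p) \<partial>N)"
  using assms by (simp add: nn_integral_powr_pos_part mult_left_mono nn_integral_mono)

lemma nn_integral_abs_powr_split:
  fixes X Y :: "'a \<Rightarrow> real"
  assumes [measurable]: "X \<in> borel_measurable M" "Y \<in> borel_measurable M"
  shows "(\<integral>\<^sup>+\<omega>. ennreal (\<bar>X \<omega> - Y \<omega>\<bar> powr p) \<partial>M) =
    (\<integral>\<^sup>+\<omega>. ennreal (max 0 (Y \<omega> - X \<omega>) powr p) \<partial>M) + (\<integral>\<^sup>+\<omega>. ennreal (max 0 (X \<omega> - Y \<omega>) powr p) \<partial>M)"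
  by (subst nn_integral_add[symmetric])
     (auto intro!: nn_integral_cong simp: max_def simp flip: ennreal_plus)

text \<open>The lower Frechet bound is attained by monotone functions. \<open>A\<close> is a
  down-set and \<open>B\<close> an up-set, so once they meet they cover the interval, and
  inclusion-exclusion gives the sum of their measures minus 1, which no pair with the same marginals
  can undercut.\<close>

lemma emeasure_comonotone_le:
  fixes X Y :: "'a \<Rightarrow> real"
  assumes f: "mono_on {0<..<1} f" and g: "mono_on {0<..<1} g"
    and "prob_space M" and [measurable]: "X \<in> borel_measurable M" "Y \<in> borel_measurable M"
    and X: "distr M borel X = distr uniform01 borel f" and Y: "distr M borel Y = distr uniform01 borel g"
  shows "emeasure uniform01 {y\<in>space uniform01. f y \<le> a \<and> b \<le> g y} \<le> emeasure M {\<omega>\<in>space M. X \<omega> \<le> a \<and> b \<le> Y \<omega>}"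
proof -
  interpret prob_space M by fact
  have [measurable]: "f \<in> borel_measurable uniform01" "g \<in> borel_measurable uniform01"
    using f g by (auto intro: measurable_uniform01_mono_on)
  define A B where "A = f -` {..a} \<inter> space uniform01" and "B = g -` {b..} \<inter> space uniform01"
  define A' B' where "A' = X -` {..a} \<inter> space M" and "B' = Y -` {b..} \<inter> space M"
  have sets[measurable]: "A \<in> sets uniform01" "B \<in> sets uniform01" "A' \<in> events" "B' \<in> events"
    unfolding A_def B_def A'_def B'_def by measurable
  have AA': "measure uniform01 A = prob A'"
    using arg_cong[OF X, of "\<lambda>D. measure D {..a}"] by (simp add: measure_distr A_def A'_def)
  have BB': "measure uniform01 B = prob B'"
    using arg_cong[OF Y, of "\<lambda>D. measure D {b..}"] by (simp add: measure_distr B_def B'_def)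
  have "measure uniform01 (A \<inter> B) \<le> prob (A' \<inter> B')"
  proof (cases "A \<inter> B = {}")
    case False
    then obtain y0 where y0: "y0 \<in> A" "y0 \<in> B" by auto
    have "A \<union> B = space uniform01"
    proof (intro antisym subsetI)
      fix y assume y: "y \<in> space uniform01"
      show "y \<in> A \<union> B"
      proof (cases "y \<le> y0")
        case True
        then show ?thesis using mono_onD[OF f, of y y0] y y0 by (auto simp: A_def)
      next
        case False
        then show ?thesis using mono_onD[OF g, of y0 y] y y0 by (auto simp: B_def)
      qed
    qed (auto simp: A_def B_def)
    then have "measure uniform01 (A \<inter> B) = measure uniform01 A + measure uniform01 B - 1"
      using measure_Un3[of A uniform01 B] uniform01.fmeasurable_eq_sets sets uniform01.prob_space by auto
    also have "\<dots> \<le> prob A' + prob B' - prob (A' \<union> B')"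
      by (simp add: AA' BB')
    also have "\<dots> = prob (A' \<inter> B')"
      using measure_Un3[of A' M B'] fmeasurable_eq_sets sets by auto
    finally show ?thesis .
  qed simp
  moreover have "A \<inter> B = {y\<in>space uniform01. f y \<le> a \<and> b \<le> g y}" "A' \<inter> B' = {\<omega>\<in>space M. X \<omega> \<le> a \<and> b \<le> Y \<omega>}"
    by (auto simp: A_def B_def A'_def B'_def)
  ultimately show ?thesis
    by (simp add: emeasure_eq_measure uniform01.emeasure_eq_measure)
qed

text \<open>The joint law of \<open>f\<close> and \<open>g\<close> is one of the couplings. Against
  any other coupling, the quadrant comparison is used twice, once for the part of the cost where the
  second coordinate is larger and once with the roles exchanged.\<close>

lemma comonotone_coupling_optimal:
  assumes p: "1 < p" and f: "mono_on {0<..<1} f" and g: "mono_on {0<..<1} g"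
  shows "(INF \<pi>\<in>couplings (distr uniform01 borel f) (distr uniform01 borel g). \<integral>\<^sup>+ z. ennreal (\<bar>fst z - snd z\<bar> powr p) \<partial>\<pi>)
    = (\<integral>\<^sup>+y. ennreal (\<bar>f y - g y\<bar> powr p) \<partial>uniform01)"
proof (rule antisym)
  have fg[measurable]: "f \<in> borel_measurable uniform01" "g \<in> borel_measurable uniform01"
    using f g by (auto intro: measurable_uniform01_mono_on)
  let ?\<pi> = "distr uniform01 borel (\<lambda>y. (f y, g y))"
  have pair[measurable]: "(\<lambda>y. (f y, g y)) \<in> borel_measurable uniform01"
    by (simp add: borel_prod[symmetric])
  have proj[measurable]: "fst \<in> borel_measurable (borel :: (real \<times> real) measure)"
      "snd \<in> borel_measurable (borel :: (real \<times> real) measure)"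
    by (simp_all add: borel_prod[symmetric])
  have "?\<pi> \<in> couplings (distr uniform01 borel f) (distr uniform01 borel g)"
    by (auto simp: couplings_def distr_distr[OF _ pair] proj comp_def intro!: uniform01.prob_space_distr)
  note INF_lower[OF this, of "\<lambda>\<pi>. \<integral>\<^sup>+ z. ennreal (\<bar>fst z - snd z\<bar> powr p) \<partial>\<pi>"]
  also have "(\<integral>\<^sup>+ z. ennreal (\<bar>fst z - snd z\<bar> powr p) \<partial>?\<pi>) = (\<integral>\<^sup>+y. ennreal (\<bar>f y - g y\<bar> powr p) \<partial>uniform01)"
    by (subst nn_integral_distr) auto
  finally show "(INF \<pi>\<in>couplings (distr uniform01 borel f) (distr uniform01 borel g). \<integral>\<^sup>+ z. ennreal (\<bar>fst z - snd z\<bar> powr p) \<partial>\<pi>)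
    \<le> (\<integral>\<^sup>+y. ennreal (\<bar>f y - g y\<bar> powr p) \<partial>uniform01)"
    .
  show "(\<integral>\<^sup>+y. ennreal (\<bar>f y - g y\<bar> powr p) \<partial>uniform01) \<le>
    (INF \<pi>\<in>couplings (distr uniform01 borel f) (distr uniform01 borel g). \<integral>\<^sup>+ z. ennreal (\<bar>fst z - snd z\<bar> powr p) \<partial>\<pi>)"
  proof (rule INF_greatest)
    fix \<pi> assume "\<pi> \<in> couplings (distr uniform01 borel f) (distr uniform01 borel g)"
    then have \<pi>: "prob_space \<pi>" and [measurable_cong]: "sets \<pi> = sets borel"
      and marg: "distr \<pi> borel fst = distr uniform01 borel f" "distr \<pi> borel snd = distr uniform01 borel g"
      by (auto simp: couplings_def)
    interpret \<pi>: prob_space \<pi> by fact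
    have [measurable]: "fst \<in> borel_measurable \<pi>" "snd \<in> borel_measurable \<pi>"
      by (simp_all add: borel_prod[symmetric] measurable_cong_sets[OF \<open>sets \<pi> = sets borel\<close> refl])
    have sf: "sigma_finite_measure uniform01" "sigma_finite_measure \<pi>" by unfold_locales
    show "(\<integral>\<^sup>+y. ennreal (\<bar>f y - g y\<bar> powr p) \<partial>uniform01) \<le> (\<integral>\<^sup>+ z. ennreal (\<bar>fst z - snd z\<bar> powr p) \<partial>\<pi>)"
      unfolding nn_integral_abs_powr_split[OF fg]
        nn_integral_abs_powr_split[OF \<open>fst \<in> borel_measurable \<pi>\<close> \<open>snd \<in> borel_measurable \<pi>\<close>]
      by (intro add_mono nn_integral_powr_pos_part_mono p sf emeasure_comonotone_le f g \<pi> marg) measurable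
  qed
qed

lemma dW_distr_uniform01:
  assumes p: "1 < p" and f: "mono_on {0<..<1} f" and g: "mono_on {0<..<1} g"
  shows "dW p (distr uniform01 borel f) (distr uniform01 borel g) = (\<integral>y. \<bar>f y - g y\<bar> powr p \<partial>uniform01) powr (1 / p)"
proof -
  have [measurable]: "f \<in> borel_measurable uniform01" "g \<in> borel_measurable uniform01"
    using f g by (auto intro: measurable_uniform01_mono_on)
  show ?thesis
    unfolding dW_def comonotone_coupling_optimal[OF assms]
    by (subst integral_eq_nn_integral) auto
qed

text \<open>Optimality gives uniqueness: the cost between \<open>f\<close> and \<open>g\<close>
  depends only on their laws, hence equals that between \<open>f\<close> and itself, which is 0. The
  exponent 2 is a choice of convenience.\<close>

lemma mono_on_distr_eq_imp_AE_eq: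
  fixes f g :: "real \<Rightarrow> real"
  assumes f: "mono_on {0<..<1} f" and g: "mono_on {0<..<1} g"
    and eq: "distr uniform01 borel f = distr uniform01 borel g"
  shows "AE y in uniform01. f y = g y"
proof -
  have [measurable]: "f \<in> borel_measurable uniform01" "g \<in> borel_measurable uniform01"
    using f g by (auto intro: measurable_uniform01_mono_on)
  have "(\<integral>\<^sup>+y. ennreal (\<bar>f y - g y\<bar> powr 2) \<partial>uniform01) = (\<integral>\<^sup>+y. ennreal (\<bar>f y - f y\<bar> powr 2) \<partial>uniform01)"
    using comonotone_coupling_optimal[of 2 f g] comonotone_coupling_optimal[of 2 f f] f g eq by simp
  then have "AE y in uniform01. ennreal (\<bar>f y - g y\<bar> powr 2) = 0"
    by (subst nn_integral_0_iff_AE[symmetric]) auto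
  then show ?thesis
    by eventually_elim (simp add: ennreal_eq_0_iff le_less not_less)
qed

lemma quantile_distr_uniform01:
  assumes mono: "mono_on {0<..<1} f" and "right_continuous01 f" and y: "y \<in> {0<..<1}"
  shows "quantile (distr uniform01 borel f) y = f y"
proof -
  interpret D: real_distribution "distr uniform01 borel f"
    by (intro real_distribution_distr_uniform01 measurable_uniform01_mono_on mono)
  show ?thesis
    using D.right_continuous01_quantile assms(2) mono_on_distr_eq_imp_AE_eq[OF D.mono_on_quantile mono D.distr_quantile] y
    by (rule right_continuous01_AE_eq)
qed

section \<open>The cone of nondecreasing functions in \<open>L\<^sup>p\<close>\<close>

text \<open>The norm of L^p without the root, so that it stays additive in the integrand. The
  Bochner integral is 0 for a non-integrable function, so integrability is always carried along
  separately.\<close>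

definition powint :: "real \<Rightarrow> (real \<Rightarrow> real) \<Rightarrow> real" where
  "powint p f = (\<integral>y. \<bar>f y\<bar> powr p \<partial>uniform01)"

lemma powint_cong: "(\<And>y. y \<in> {0<..<1} \<Longrightarrow> \<bar>f y\<bar> = \<bar>g y\<bar>) \<Longrightarrow> powint p f = powint p g"
  unfolding powint_def by (intro Bochner_Integration.integral_cong) auto

lemma powint_nonneg: "0 \<le> powint p f"
  by (simp add: powint_def)

lemma powint_const [simp]: "powint p (\<lambda>_. c) = \<bar>c\<bar> powr p"
  by (simp add: powint_def uniform01.prob_space[simplified])

lemma powint_scale: "powint p (\<lambda>y. c * f y) = \<bar>c\<bar> powr p * powint p f"
  by (simp add: powint_def abs_mult powr_mult)

lemma integrable_powr_add:
  fixes f g :: "'a \<Rightarrow> real"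
  assumes "0 \<le> p" and [measurable]: "f \<in> borel_measurable M" "g \<in> borel_measurable M"
    and "integrable M (\<lambda>y. \<bar>f y\<bar> powr p)" "integrable M (\<lambda>y. \<bar>g y\<bar> powr p)"
  shows "integrable M (\<lambda>y. \<bar>f y + g y\<bar> powr p)"
proof (rule Bochner_Integration.integrable_bound)
  show "integrable M (\<lambda>y. 2 powr p * (\<bar>f y\<bar> powr p + \<bar>g y\<bar> powr p))"
    using assms by auto
qed (use abs_powr_add_le[OF assms(1)] in auto)

lemma integrable_powr_diff:
  fixes f g :: "'a \<Rightarrow> real"
  assumes "0 \<le> p" "f \<in> borel_measurable M" "g \<in> borel_measurable M"
    and "integrable M (\<lambda>y. \<bar>f y\<bar> powr p)" "integrable M (\<lambda>y. \<bar>g y\<bar> powr p)"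
  shows "integrable M (\<lambda>y. \<bar>f y - g y\<bar> powr p)"
  using integrable_powr_add[of p f M "\<lambda>y. - g y"] assms by simp

text \<open>The image of \<open>Wp p\<close> under the quantile map, up to values outside the open unit interval.\<close>
definition nondec_Lp :: "real \<Rightarrow> (real \<Rightarrow> real) set" where
  "nondec_Lp p = {f. mono_on {0<..<1} f \<and> right_continuous01 f \<and> integrable uniform01 (\<lambda>y. \<bar>f y\<bar> powr p)}"

lemma nondec_LpD:
  assumes "f \<in> nondec_Lp p"
  shows "mono_on {0<..<1} f" "right_continuous01 f" "integrable uniform01 (\<lambda>y. \<bar>f y\<bar> powr p)"
    "f \<in> borel_measurable uniform01"
  using assms measurable_uniform01_mono_on by (auto simp: nondec_Lp_def)

lemma nondec_Lp_const [simp]: "(\<lambda>_. c) \<in> nondec_Lp p"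
  by (auto simp: nondec_Lp_def mono_on_def)

lemma nondec_Lp_add:
  assumes "0 \<le> p" and f: "f \<in> nondec_Lp p" and g: "g \<in> nondec_Lp p"
  shows "(\<lambda>y. f y + g y) \<in> nondec_Lp p"
proof -
  have "mono_on {0<..<1} (\<lambda>y. f y + g y)"
    by (intro mono_onI add_mono mono_onD[OF nondec_LpD(1)[OF f]] mono_onD[OF nondec_LpD(1)[OF g]])
  then show ?thesis
    unfolding nondec_Lp_def
    using nondec_LpD[OF f] nondec_LpD[OF g] assms(1)
    by (simp add: right_continuous01_add integrable_powr_add)
qed

lemma nondec_Lp_scale:
  assumes "0 \<le> c" and f: "f \<in> nondec_Lp p"
  shows "(\<lambda>y. c * f y) \<in> nondec_Lp p"
proof -
  have "mono_on {0<..<1} (\<lambda>y. c * f y)"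
    by (intro mono_onI mult_left_mono mono_onD[OF nondec_LpD(1)[OF f]] assms(1))
  then show ?thesis
    unfolding nondec_Lp_def
    using nondec_LpD[OF f] right_continuous01_mult[of "\<lambda>_. c" f]
    by (simp add: abs_mult powr_mult)
qed

lemma nondec_Lp_integrable_diff:
  "0 \<le> p \<Longrightarrow> f \<in> nondec_Lp p \<Longrightarrow> g \<in> nondec_Lp p \<Longrightarrow> integrable uniform01 (\<lambda>y. \<bar>f y - g y\<bar> powr p)"
  by (intro integrable_powr_diff nondec_LpD)

lemma powint_diff_eq_0D:
  assumes "0 \<le> p" "f \<in> nondec_Lp p" "g \<in> nondec_Lp p" "powint p (\<lambda>y. f y - g y) = 0" "y \<in> {0<..<1}"
  shows "f y = g y"
proof -
  have "AE y in uniform01. \<bar>f y - g y\<bar> powr p = 0"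
    using assms(4) nondec_Lp_integrable_diff[OF assms(1-3)]
    by (subst integral_nonneg_eq_0_iff_AE[symmetric]) (auto simp: powint_def)
  then have "AE y in uniform01. f y = g y" by simp
  then show ?thesis
    using assms by (intro right_continuous01_AE_eq[of f g]) (auto dest: nondec_LpD)
qed

text \<open>The non-strict \<open>c \<le> f y\<close> matters: the set where \<open>c < f y\<close>
  may be an interval open on the left, whose indicator is not right continuous.\<close>

lemma nondec_Lp_superlevel:
  assumes "f \<in> nondec_Lp p"
  shows "(\<lambda>y. of_bool (c \<le> f y)) \<in> nondec_Lp p"
proof -
  note f = nondec_LpD[OF assms]
  note [measurable] = f(4)
  have "right_continuous01 (\<lambda>y. of_bool (c \<le> f y) :: real)"
    unfolding right_continuous01_def continuous_within
  proof
    fix y :: real assume y: "y \<in> {0<..<1}"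
    have "eventually (\<lambda>z. of_bool (c \<le> f z) = (of_bool (c \<le> f y) :: real)) (at_right y)"
    proof (cases "c \<le> f y")
      case True
      have "eventually (\<lambda>z. z \<in> {y<..<1}) (at_right y)"
        using y by (intro eventually_at_rightI) auto
      then show ?thesis
        by eventually_elim (use True y mono_onD[OF f(1), of y] in \<open>force intro: order_trans\<close>)
    next
      case False
      have "(f \<longlongrightarrow> f y) (at_right y)"
        using f(2) y by (auto simp: right_continuous01_def continuous_within)
      then have "eventually (\<lambda>z. f z < c) (at_right y)"
        using False by (intro order_tendstoD) auto
      then show ?thesis
        by eventually_elim (use False in auto)
    qed
    then show "((\<lambda>z. of_bool (c \<le> f z) :: real) \<longlongrightarrow> of_bool (c \<le> f y)) (at_right y)"
      by (rule tendsto_eventually)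
  qed
  moreover have "mono_on {0<..<1} (\<lambda>y. of_bool (c \<le> f y) :: real)"
    using mono_onD[OF f(1)] by (fastforce intro!: mono_onI)
  moreover have "integrable uniform01 (\<lambda>y. \<bar>of_bool (c \<le> f y) :: real\<bar> powr p)"
    by (rule uniform01.integrable_const_bound[of _ 1]) auto
  ultimately show ?thesis by (simp add: nondec_Lp_def)
qed

lemma nondec_Lp_sum:
  assumes "0 \<le> p" "finite S" "\<And>k. k \<in> S \<Longrightarrow> g k \<in> nondec_Lp p"
  shows "(\<lambda>y. \<Sum>k\<in>S. g k y) \<in> nondec_Lp p"
  using assms(2,3)
proof (induction S rule: finite_induct)
  case (insert k S)
  then show ?case
    using nondec_Lp_add[OF assms(1), of "g k" "\<lambda>y. \<Sum>k\<in>S. g k y"] by simp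
qed simp

text \<open>For positive \<open>n\<close>, truncation to the interval from \<open>-n\<close> to
  \<open>n\<close> followed by rounding down to a multiple of \<open>1 / n\<close>. It is written
  with nonnegative coefficients and one constant, since a cone admits no subtraction of
  indicators.\<close>

definition step_approx :: "nat \<Rightarrow> real \<Rightarrow> real" where
  "step_approx n x = (\<Sum>k\<in>{1..2 * n^2}. (1 / n) * of_bool (k / n - n \<le> x)) + (- real n)"

text \<open>In the scaled variable \<open>z\<close> the sum counts the positive integers up to
  \<open>z\<close>, capped at \<open>2 * n^2\<close>. The first bound gives pointwise convergence,
  the second an integrable majorant that does not depend on \<open>n\<close>.\<close>

lemma step_approx_error:
  assumes n: "0 < n"
  shows "\<bar>x\<bar> \<le> n \<Longrightarrow> \<bar>step_approx n x - x\<bar> \<le> 1 / n"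
    and "\<bar>step_approx n x - x\<bar> \<le> \<bar>x\<bar> + 1"
proof -
  define z where "z = (x + n) * n"
  have iff: "k / n - n \<le> x \<longleftrightarrow> k \<le> z" for k :: nat
    using n by (simp add: z_def field_simps)
  have floor: "real k \<le> z \<longleftrightarrow> k \<le> nat \<lfloor>z\<rfloor>" if "1 \<le> k" for k :: nat
  proof (cases "0 \<le> z")
    case True
    then show ?thesis by (simp add: le_nat_iff le_floor_iff)
  qed (use that in auto)
  have x: "x = z / n - n"
    using n by (simp add: z_def)
  have "{1..2 * n^2} \<inter> {k. real k \<le> z} = {1..min (2 * n^2) (nat \<lfloor>z\<rfloor>)}"
    using floor by auto
  then have count: "(\<Sum>k\<in>{1..2 * n^2}. of_bool (real k \<le> z)) = real (min (2 * n^2) (nat \<lfloor>z\<rfloor>))"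
    by (simp add: of_bool_def sum.If_cases)
  have "step_approx n x = (1 / n) * (\<Sum>k\<in>{1..2 * n^2}. of_bool (real k \<le> z)) + - real n"
    by (simp only: step_approx_def iff sum_distrib_left)
  then have S: "step_approx n x = real (min (2 * n^2) (nat \<lfloor>z\<rfloor>)) / n - n"
    by (simp only: count) simp
  consider "z < 0" | "0 \<le> z" "z \<le> 2 * n^2" | "2 * n^2 < z" by linarith
  note cs = this
  have mid: "\<bar>step_approx n x - x\<bar> \<le> 1 / n" if "0 \<le> z" "z \<le> 2 * n^2"
  proof -
    have "nat \<lfloor>z\<rfloor> \<le> 2 * n^2" using that by (simp add: nat_le_iff floor_le_iff)
    then have "step_approx n x = real (nat \<lfloor>z\<rfloor>) / n - n" by (simp add: S min_def)
    also have "real (nat \<lfloor>z\<rfloor>) = of_int \<lfloor>z\<rfloor>" using that by simp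
    finally have "step_approx n x - x = (of_int \<lfloor>z\<rfloor> - z) / n" by (simp add: x diff_divide_distrib)
    moreover have "\<bar>of_int \<lfloor>z\<rfloor> - z\<bar> \<le> 1" by linarith
    ultimately show ?thesis using n by (simp add: divide_right_mono)
  qed
  have low: "step_approx n x = - n \<and> x < - n" if "z < 0"
    using that n by (simp add: S) (simp add: z_def mult_less_0_iff)
  have high: "step_approx n x = n \<and> n < x" if "2 * n^2 < z"
  proof -
    have "2 * n^2 \<le> nat \<lfloor>z\<rfloor>" using that by (simp add: le_nat_floor)
    then have "step_approx n x = n" using n by (simp add: S min_def power2_eq_square)
    moreover have "n * (2 * n) < n * (x + n)" using that by (simp add: z_def power2_eq_square mult_ac)
    then have "n < x" using n by simp
    ultimately show ?thesis by simp
  qed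
  show "\<bar>step_approx n x - x\<bar> \<le> 1 / n" if "\<bar>x\<bar> \<le> n"
    using cs that low high mid by (cases rule: cs) auto
  have "1 / n \<le> 1" using n by simp
  then show "\<bar>step_approx n x - x\<bar> \<le> \<bar>x\<bar> + 1"
    using low high mid by (cases rule: cs) auto
qed

lemma nondec_Lp_step_approx:
  assumes "0 \<le> p" "f \<in> nondec_Lp p"
  shows "(\<lambda>y. step_approx n (f y)) \<in> nondec_Lp p"
  unfolding step_approx_def
  by (intro nondec_Lp_add nondec_Lp_sum nondec_Lp_scale nondec_Lp_superlevel nondec_Lp_const assms) auto

lemma step_approx_tendsto:
  assumes p: "0 < p" and f: "f \<in> nondec_Lp p"
  shows "(\<lambda>n. powint p (\<lambda>y. step_approx n (f y) - f y)) \<longlonglongrightarrow> 0"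
proof -
  have meas: "(\<lambda>y. step_approx n (f y)) \<in> borel_measurable uniform01" for n
    using nondec_LpD(4)[OF nondec_Lp_step_approx[OF _ f]] p by simp
  note [measurable] = meas nondec_LpD(4)[OF f]
  \<comment> \<open>The error bounds hold for positive indices only, hence the shift to
    \<open>Suc n\<close>.\<close>
  have "(\<lambda>n. \<integral>y. \<bar>step_approx (Suc n) (f y) - f y\<bar> powr p \<partial>uniform01) \<longlonglongrightarrow> (\<integral>y. 0 \<partial>uniform01)"
  proof (rule integral_dominated_convergence)
    show "integrable uniform01 (\<lambda>y. \<bar>\<bar>f y\<bar> + 1\<bar> powr p)"
      using nondec_LpD(3)[OF f] p by (intro integrable_powr_add) auto
    show "AE y in uniform01. norm (\<bar>step_approx (Suc n) (f y) - f y\<bar> powr p) \<le> \<bar>\<bar>f y\<bar> + 1\<bar> powr p" for n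
      using step_approx_error(2)[of "Suc n"] p by (intro AE_I2) (auto intro!: powr_mono2)
    show "AE y in uniform01. (\<lambda>n. \<bar>step_approx (Suc n) (f y) - f y\<bar> powr p) \<longlonglongrightarrow> 0"
    proof (rule AE_I2)
      fix y
      obtain N :: nat where N: "\<bar>f y\<bar> \<le> N" using real_arch_simple by blast
      have "(\<lambda>n. \<bar>step_approx (Suc n) (f y) - f y\<bar>) \<longlonglongrightarrow> 0"
      proof (rule tendsto_sandwich[OF _ _ tendsto_const LIMSEQ_inverse_real_of_nat])
        show "eventually (\<lambda>n. \<bar>step_approx (Suc n) (f y) - f y\<bar> \<le> inverse (real (Suc n))) sequentially"
          using eventually_ge_at_top[of N]
        proof eventually_elim
          case (elim n)
          then show ?case using step_approx_error(1)[of "Suc n" "f y"] N by (simp add: inverse_eq_divide)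
        qed
      qed simp
      then have "(\<lambda>n. \<bar>step_approx (Suc n) (f y) - f y\<bar> powr p) \<longlonglongrightarrow> 0 powr p"
        using p by (intro tendsto_powr2) auto
      then show "(\<lambda>n. \<bar>step_approx (Suc n) (f y) - f y\<bar> powr p) \<longlonglongrightarrow> 0" by simp
    qed
  qed measurable
  then have "(\<lambda>n. powint p (\<lambda>y. step_approx (Suc n) (f y) - f y)) \<longlonglongrightarrow> 0"
    by (simp add: powint_def)
  then show ?thesis by (rule LIMSEQ_imp_Suc)
qed

section \<open>Isometric embeddings of the cone\<close>

text \<open>Equality case of strict convexity, integrated: it forces points that divide a geodesic
  in \<open>L\<^sup>p\<close> to lie on the segment.\<close>
lemma powint_strict_convexity:
  assumes p: "1 < p" and t: "0 < t" "t < 1"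
    and [measurable]: "a \<in> borel_measurable uniform01" "b \<in> borel_measurable uniform01"
    and a: "integrable uniform01 (\<lambda>y. \<bar>a y\<bar> powr p)" and b: "integrable uniform01 (\<lambda>y. \<bar>b y\<bar> powr p)"
    and D: "powint p a = t powr p * D" "powint p b = (1 - t) powr p * D" "powint p (\<lambda>y. a y + b y) = D"
  shows "AE y in uniform01. (1 - t) * a y = t * b y"
proof -
  \<comment> \<open>The convexity gap at \<open>a y / t\<close> and \<open>b y / (1 - t)\<close>,
    whose weighted mean is \<open>a y + b y\<close>. The scaling of the three norms makes its
    integral \<open>t * D + (1 - t) * D - D\<close>.\<close>
  define h where "h y = t * \<bar>a y / t\<bar> powr p + (1 - t) * \<bar>b y / (1 - t)\<bar> powr p - \<bar>a y + b y\<bar> powr p" for y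
  have a': "integrable uniform01 (\<lambda>y. \<bar>a y / t\<bar> powr p)" and b': "integrable uniform01 (\<lambda>y. \<bar>b y / (1 - t)\<bar> powr p)"
    using a b by (auto simp: powr_divide)
  have ab: "integrable uniform01 (\<lambda>y. \<bar>a y + b y\<bar> powr p)"
    using p a b by (intro integrable_powr_add) auto
  have int: "integrable uniform01 h"
    unfolding h_def by (intro Bochner_Integration.integrable_diff Bochner_Integration.integrable_add integrable_mult_right a' b' ab)
  have pos: "h y > 0" if "(1 - t) * a y \<noteq> t * b y" for y
  proof -
    have "a y / t \<noteq> b y / (1 - t)" using that t by (auto simp: field_simps)
    from abs_powr_strict_convex[OF p t this] show ?thesis
      using t by (simp add: h_def)
  qed
  have zero: "h y = 0" if "(1 - t) * a y = t * b y" for y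
  proof -
    have eq: "b y / (1 - t) = a y / t" using that t by (auto simp: field_simps)
    have "a y + b y = a y / t" using that t by (auto simp: field_simps)
    then show ?thesis unfolding h_def eq by (simp add: algebra_simps)
  qed
  have "(\<integral>y. h y \<partial>uniform01) = t * powint p (\<lambda>y. a y / t) + (1 - t) * powint p (\<lambda>y. b y / (1 - t)) - D"
    unfolding h_def D(3)[symmetric] powint_def
    using a' b' ab by (simp add: Bochner_Integration.integral_diff Bochner_Integration.integral_add)
  also have "powint p (\<lambda>y. a y / t) = D"
    using t powint_scale[of p "1 / t" a] by (simp add: D powr_divide)
  also have "powint p (\<lambda>y. b y / (1 - t)) = D"
    using t powint_scale[of p "1 / (1 - t)" b] by (simp add: D powr_divide)
  finally have "(\<integral>y. h y \<partial>uniform01) = 0" by (simp add: algebra_simps)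
  moreover have "0 \<le> h y" for y using pos[of y] zero[of y] by force
  ultimately have "AE y in uniform01. h y = 0"
    using integral_nonneg_eq_0_iff_AE[OF int] by simp
  then show ?thesis
    by eventually_elim (use pos in force)
qed

text \<open>The assumptions constrain functions only inside the open unit interval, hence the
  condition on \<open>y\<close> in the pointwise conclusions that follow.\<close>

locale isometric_self_map =
  fixes p :: real and \<Phi> :: "(real \<Rightarrow> real) \<Rightarrow> real \<Rightarrow> real"
  assumes p_gt_1: "1 < p"
    and maps: "f \<in> nondec_Lp p \<Longrightarrow> \<Phi> f \<in> nondec_Lp p"
    and isometric: "f \<in> nondec_Lp p \<Longrightarrow> g \<in> nondec_Lp p \<Longrightarrow>
      powint p (\<lambda>y. \<Phi> f y - \<Phi> g y) = powint p (\<lambda>y. f y - g y)"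
begin

lemma p_ge_0: "0 \<le> p"
  using p_gt_1 by simp

lemmas nondec_Lp_intros = nondec_Lp_const nondec_Lp_add[OF p_ge_0] nondec_Lp_scale

text \<open>The distances from the image of the intermediate point to the images of \<open>f\<close>
  and \<open>g\<close> are the fractions \<open>t\<close> and \<open>1 - t\<close> of the distance
  between the latter, which is the equality case of strict convexity.\<close>

lemma affine:
  assumes f: "f \<in> nondec_Lp p" and g: "g \<in> nondec_Lp p" and t: "0 < t" "t < 1" and y: "y \<in> {0<..<1}"
  shows "\<Phi> (\<lambda>y. (1 - t) * f y + t * g y) y = (1 - t) * \<Phi> f y + t * \<Phi> g y"
proof -
  define m where "m = (\<lambda>y. (1 - t) * f y + t * g y)"
  have m: "m \<in> nondec_Lp p"
    unfolding m_def using f g t by (intro nondec_Lp_intros) auto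
  note [measurable] = nondec_LpD(4)[OF maps[OF f]] nondec_LpD(4)[OF maps[OF g]] nondec_LpD(4)[OF maps[OF m]]
  have "AE y in uniform01. (1 - t) * (\<Phi> m y - \<Phi> f y) = t * (\<Phi> g y - \<Phi> m y)"
  proof (rule powint_strict_convexity[OF p_gt_1 t])
    have "powint p (\<lambda>y. \<Phi> m y - \<Phi> f y) = powint p (\<lambda>y. t * (g y - f y))"
      unfolding isometric[OF m f] by (intro powint_cong) (simp add: m_def algebra_simps)
    then show "powint p (\<lambda>y. \<Phi> m y - \<Phi> f y) = t powr p * powint p (\<lambda>y. g y - f y)"
      using t by (simp add: powint_scale)
    have "powint p (\<lambda>y. \<Phi> g y - \<Phi> m y) = powint p (\<lambda>y. (1 - t) * (g y - f y))"
      unfolding isometric[OF g m] by (intro powint_cong) (simp add: m_def algebra_simps)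
    then show "powint p (\<lambda>y. \<Phi> g y - \<Phi> m y) = (1 - t) powr p * powint p (\<lambda>y. g y - f y)"
      using t by (simp add: powint_scale)
    show "powint p (\<lambda>y. \<Phi> m y - \<Phi> f y + (\<Phi> g y - \<Phi> m y)) = powint p (\<lambda>y. g y - f y)"
      using isometric[OF g f] by simp
  qed (use f g m in \<open>auto intro!: nondec_Lp_integrable_diff[OF p_ge_0] maps\<close>)
  then have "AE y in uniform01. \<Phi> m y = (1 - t) * \<Phi> f y + t * \<Phi> g y"
    by eventually_elim (simp add: algebra_simps)
  then show ?thesis
    unfolding m_def[symmetric]
    using f g m y
    by (intro right_continuous01_AE_eq[of "\<Phi> m"] right_continuous01_add right_continuous01_mult)
       (auto intro!: nondec_LpD(2) maps)
qed

definition lin :: "(real \<Rightarrow> real) \<Rightarrow> real \<Rightarrow> real" where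
  "lin f y = \<Phi> f y - \<Phi> (\<lambda>_. 0) y"

lemma powint_lin_diff:
  "f \<in> nondec_Lp p \<Longrightarrow> g \<in> nondec_Lp p \<Longrightarrow> powint p (\<lambda>y. lin f y - lin g y) = powint p (\<lambda>y. f y - g y)"
  using isometric[of f g] by (simp add: lin_def)

lemma lin_zero [simp]: "lin (\<lambda>_. 0) y = 0"
  by (simp add: lin_def)

lemma powint_lin: "f \<in> nondec_Lp p \<Longrightarrow> powint p (lin f) = powint p f"
  using powint_lin_diff[of f "\<lambda>_. 0"] by simp

lemma lin_scale:
  assumes f: "f \<in> nondec_Lp p" and "0 \<le> c" and y: "y \<in> {0<..<1}"
  shows "lin (\<lambda>y. c * f y) y = c * lin f y"
proof -
  have less_1: "lin (\<lambda>y. t * g y) y = t * lin g y" if "g \<in> nondec_Lp p" "0 < t" "t < 1" for t g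
    using affine[of "\<lambda>_. 0" g t y] that y by (simp add: lin_def algebra_simps)
  consider "c = 0" | "0 < c" "c < 1" | "c = 1" | "1 < c" using assms(2) by linarith
  then show ?thesis
  proof cases
    \<comment> \<open>For \<open>c > 1\<close> the function is recovered from \<open>c * f\<close>
      by the factor \<open>1 / c\<close>, which is covered by the segment from 0.\<close>
    case 4
    have "(\<lambda>y. c * f y) \<in> nondec_Lp p" using assms by (intro nondec_Lp_intros)
    then have "lin (\<lambda>y. (1 / c) * (c * f y)) y = (1 / c) * lin (\<lambda>y. c * f y) y"
      using 4 by (intro less_1) auto
    then show ?thesis using 4 by simp
  qed (use less_1 f in auto)
qed

text \<open>The sum is the midpoint of \<open>2 * f\<close> and \<open>2 * g\<close>, both of which
  belong to the cone.\<close>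

lemma lin_add:
  assumes f: "f \<in> nondec_Lp p" and g: "g \<in> nondec_Lp p" and y: "y \<in> {0<..<1}"
  shows "lin (\<lambda>y. f y + g y) y = lin f y + lin g y"
proof -
  have fg: "(\<lambda>y. 2 * f y) \<in> nondec_Lp p" "(\<lambda>y. 2 * g y) \<in> nondec_Lp p"
    using f g by (auto intro!: nondec_Lp_intros)
  have "\<Phi> (\<lambda>y. f y + g y) y = (\<Phi> (\<lambda>y. 2 * f y) y + \<Phi> (\<lambda>y. 2 * g y) y) / 2"
    using affine[OF fg, of "1/2"] y by (simp add: field_simps)
  then have "lin (\<lambda>y. f y + g y) y = (lin (\<lambda>y. 2 * f y) y + lin (\<lambda>y. 2 * g y) y) / 2"
    by (simp add: lin_def field_simps)
  then show ?thesis using lin_scale[of _ 2 y] f g y by simp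
qed

text \<open>\<open>\<Phi> (n f) = \<Phi> 0 + n lin f\<close> is nondecreasing for every \<open>n\<close>.\<close>
lemma lin_nondec:
  assumes f: "f \<in> nondec_Lp p"
  shows "lin f \<in> nondec_Lp p"
proof -
  have "mono_on {0<..<1} (lin f)"
  proof (rule mono_onI, rule ccontr)
    fix y z :: real assume yz: "y \<in> {0<..<1}" "z \<in> {0<..<1}" "y \<le> z" "\<not> lin f y \<le> lin f z"
    define d where "d = lin f y - lin f z"
    have d: "0 < d" using yz by (simp add: d_def)
    obtain n :: nat where n: "\<Phi> (\<lambda>_. 0) z - \<Phi> (\<lambda>_. 0) y < n * d"
      using reals_Archimedean3[OF d] by blast
    have "(\<lambda>y. real n * f y) \<in> nondec_Lp p" using f by (intro nondec_Lp_intros) auto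
    then have "\<Phi> (\<lambda>y. real n * f y) y \<le> \<Phi> (\<lambda>y. real n * f y) z"
      using yz by (intro mono_onD[OF nondec_LpD(1)[OF maps]])
    moreover have "\<Phi> (\<lambda>y. real n * f y) x = \<Phi> (\<lambda>_. 0) x + n * lin f x" if "x \<in> {0<..<1}" for x
      using lin_scale[OF f _ that, of n] by (simp add: lin_def)
    ultimately show False using yz n by (simp add: d_def algebra_simps)
  qed
  then show ?thesis
    unfolding nondec_Lp_def lin_def
    using right_continuous01_diff[OF nondec_LpD(2)[OF maps[OF f]] nondec_LpD(2)[OF maps[OF nondec_Lp_const, of 0]]]
      nondec_Lp_integrable_diff[OF p_ge_0 maps[OF f] maps[OF nondec_Lp_const, of 0]]
    by simp
qed

text \<open>The images of 1 and -1 are negatives of each other and both nondecreasing, so they are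
  constant; preservation of the norm leaves modulus 1.\<close>

lemma lin_one: "\<exists>\<sigma>\<in>{1, -1}. \<forall>y\<in>{0<..<1}. lin (\<lambda>_. 1) y = \<sigma>"
proof -
  have neg: "lin (\<lambda>_. - 1) y = - lin (\<lambda>_. 1) y" if "y \<in> {0<..<1}" for y
    using lin_add[of "\<lambda>_. 1" "\<lambda>_. - 1" y] that by simp
  define \<sigma> where "\<sigma> = lin (\<lambda>_. 1) (1/2)"
  have const: "lin (\<lambda>_. 1) y = \<sigma>" if "y \<in> {0<..<1}" for y
  proof -
    have eq: "lin (\<lambda>_. 1) u = lin (\<lambda>_. 1) v" if uv: "u \<in> {0<..<1}" "v \<in> {0<..<1}" "u \<le> v" for u v
      using mono_onD[OF nondec_LpD(1)[OF lin_nondec], of "\<lambda>_. 1" u v]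
        mono_onD[OF nondec_LpD(1)[OF lin_nondec], of "\<lambda>_. - 1" u v] uv neg by simp
    show ?thesis
      unfolding \<sigma>_def using eq[of y "1/2"] eq[of "1/2" y] that by (cases "y \<le> 1/2") auto
  qed
  have "\<bar>\<sigma>\<bar> powr p = powint p (lin (\<lambda>_. 1))"
    unfolding powint_const[symmetric] by (intro powint_cong) (simp add: const)
  then have "\<bar>\<sigma>\<bar> powr p = 1" by (simp add: powint_lin)
  then have "\<bar>\<sigma>\<bar> = 1" using p_gt_1 by (smt (verit) powr_eq_one_iff_gen powr_eq_0_iff powr_ge_zero)
  then show ?thesis using const by (auto simp: abs_if split: if_splits)
qed

end

locale orientation_preserving = isometric_self_map +
  assumes p_neq_2: "p \<noteq> 2" and lin_one_eq: "y \<in> {0<..<1} \<Longrightarrow> lin (\<lambda>_. 1) y = 1"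
begin

lemma lin_neg_one: "y \<in> {0<..<1} \<Longrightarrow> lin (\<lambda>_. - 1) y = - 1"
  using lin_add[of "\<lambda>_. 1" "\<lambda>_. - 1" y] lin_one_eq[of y] by simp

text \<open>Homogeneity holds for nonnegative factors only, so a negative constant is treated as a
  multiple of -1.\<close>

lemma lin_const: "y \<in> {0<..<1} \<Longrightarrow> lin (\<lambda>_. c) y = c"
  using lin_scale[of "\<lambda>_. 1" c y] lin_scale[of "\<lambda>_. - 1" "- c" y] lin_one_eq[of y] lin_neg_one[of y]
  by (cases "0 \<le> c") auto

lemma integral_clarkson_deficit:
  assumes f: "f \<in> nondec_Lp p"
  shows "integrable uniform01 (\<lambda>y. clarkson_deficit p (f y))"
    and "(\<integral>y. clarkson_deficit p (f y) \<partial>uniform01) =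
      1 + powint p (\<lambda>y. 2 * f y - 1) - 2 * powint p f - 2 * powint p (\<lambda>y. 1 - f y)"
proof -
  have "(\<lambda>y. 2 * f y) \<in> nondec_Lp p" using f by (intro nondec_Lp_intros) auto
  note int = nondec_Lp_integrable_diff[OF p_ge_0 this nondec_Lp_const, of 1]
    nondec_Lp_integrable_diff[OF p_ge_0 nondec_Lp_const f, of 1] nondec_LpD(3)[OF f]
  from int show "integrable uniform01 (\<lambda>y. clarkson_deficit p (f y))"
    by (auto simp: clarkson_deficit_def)
  show "(\<integral>y. clarkson_deficit p (f y) \<partial>uniform01) =
      1 + powint p (\<lambda>y. 2 * f y - 1) - 2 * powint p f - 2 * powint p (\<lambda>y. 1 - f y)"
    using int by (simp add: clarkson_deficit_def powint_def uniform01.prob_space[simplified])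
qed

text \<open>Every term of the integrated deficit is a norm or a distance preserved by
  \<open>lin\<close>, so the deficits of \<open>v\<close> and \<open>J\<close> have the same
  integral, namely 0. As the deficit has constant sign, it vanishes almost everywhere along
  \<open>v\<close>.\<close>

lemma lin_zero_one_valued:
  assumes J: "J \<in> nondec_Lp p" and J01: "\<And>y. y \<in> {0<..<1} \<Longrightarrow> J y \<in> {0, 1}" and y: "y \<in> {0<..<1}"
  shows "lin J y = J y"
proof -
  define v where "v = lin J"
  have v: "v \<in> nondec_Lp p" using lin_nondec[OF J] by (simp add: v_def)
  have J2: "(\<lambda>y. 2 * J y) \<in> nondec_Lp p" using J by (intro nondec_Lp_intros) auto
  \<comment> \<open>Adding the constant -1 exhibits \<open>2 * J - 1\<close> as a sum inside the
    cone, where additivity of \<open>lin\<close> applies.\<close>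
  then have J2': "(\<lambda>y. 2 * J y + - 1) \<in> nondec_Lp p" by (intro nondec_Lp_add[OF p_ge_0] nondec_Lp_const)
  have "lin (\<lambda>y. 2 * J y + - 1) y = 2 * v y - 1" if "y \<in> {0<..<1}" for y
    using lin_add[OF J2, of "\<lambda>_. - 1" y] lin_scale[OF J, of 2 y] lin_neg_one that by (simp add: v_def)
  then have "powint p (\<lambda>y. 2 * v y - 1) = powint p (lin (\<lambda>y. 2 * J y + - 1))"
    by (intro powint_cong) auto
  then have 1: "powint p (\<lambda>y. 2 * v y - 1) = powint p (\<lambda>y. 2 * J y - 1)"
    using powint_lin[OF J2'] by simp
  \<comment> \<open>\<open>1 - J\<close> need not be nondecreasing; its norm is reached as the
    distance between the cone elements 1 and \<open>J\<close>.\<close>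
  have "powint p (\<lambda>y. 1 - v y) = powint p (\<lambda>y. lin (\<lambda>_. 1) y - lin J y)"
    by (intro powint_cong) (simp add: lin_one_eq v_def)
  then have 2: "powint p (\<lambda>y. 1 - v y) = powint p (\<lambda>y. 1 - J y)"
    using powint_lin_diff[OF nondec_Lp_const J] by simp
  have 3: "powint p v = powint p J"
    using powint_lin[OF J] by (simp add: v_def)
  have "(\<integral>y. clarkson_deficit p (v y) \<partial>uniform01) = (\<integral>y. clarkson_deficit p (J y) \<partial>uniform01)"
    by (simp add: integral_clarkson_deficit v J 1 2 3)
  also have "\<dots> = (\<integral>y. 0 \<partial>uniform01)"
    using J01 clarkson_deficit_cases(1)[OF p_gt_1] by (intro Bochner_Integration.integral_cong) auto
  finally have zero: "(\<integral>y. clarkson_deficit p (v y) \<partial>uniform01) = 0" by simp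
  have "AE y in uniform01. clarkson_deficit p (v y) = 0"
  proof (cases "p > 2")
    case True
    have "0 \<le> clarkson_deficit p x" for x
      using clarkson_deficit_cases(1,2)[OF p_gt_1, of x] True by force
    then show ?thesis
      using zero integral_nonneg_eq_0_iff_AE[OF integral_clarkson_deficit(1)[OF v]] by simp
  next
    case False
    then have "p < 2" using p_neq_2 by simp
    then have "0 \<le> - clarkson_deficit p x" for x
      using clarkson_deficit_cases(1,3)[OF p_gt_1, of x] by force
    then show ?thesis
      using zero integral_nonneg_eq_0_iff_AE[of uniform01 "\<lambda>y. - clarkson_deficit p (v y)"]
        integral_clarkson_deficit(1)[OF v] by simp
  qed
  \<comment> \<open>The product turns the alternative between 0 and 1 into an equation between
    right-continuous functions, which then extends to every point.\<close>
  then have "AE y in uniform01. v y * (1 - v y) = 0"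
    by eventually_elim
       (use clarkson_deficit_cases(2,3)[OF p_gt_1] p_neq_2 in \<open>metis less_irrefl linorder_neqE_linordered_idom mult_eq_0_iff right_minus_eq\<close>)
  then have "v y * (1 - v y) = 0" if "y \<in> {0<..<1}" for y
    using nondec_LpD(2)[OF v] that
    by (intro right_continuous01_AE_eq[of "\<lambda>y. v y * (1 - v y)" "\<lambda>_. 0"] right_continuous01_mult right_continuous01_diff) auto
  then have v01: "v y \<in> {0, 1}" if "y \<in> {0<..<1}" for y using that by force
  \<comment> \<open>For 0-1 valued functions the power is invisible, so equality of norms is
    equality of integrals, that is, of the lengths of the up-sets.\<close>
  have int_eq: "integrable uniform01 f \<and> (\<integral>y. f y \<partial>uniform01) = powint p f"
    if f: "f \<in> nondec_Lp p" and f01: "\<And>y. y \<in> {0<..<1} \<Longrightarrow> f y \<in> {0, 1}" for f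
  proof -
    have eq: "f y = \<bar>f y\<bar> powr p" if "y \<in> space uniform01" for y using f01[of y] that by force
    show ?thesis
      unfolding powint_def using nondec_LpD(3)[OF f] eq
      by (metis (no_types, lifting) Bochner_Integration.integrable_cong Bochner_Integration.integral_cong)
  qed
  note vi = int_eq[OF v v01] and Ji = int_eq[OF J J01]
  \<comment> \<open>The factor \<open>\<epsilon>\<close> serves both possible inclusions: a
    difference of constant sign with integral 0 vanishes almost everywhere.\<close>
  have AE: "AE y in uniform01. v y = J y"
    if nest: "\<And>y. y \<in> {0<..<1} \<Longrightarrow> 0 \<le> \<epsilon> * (v y - J y)" and "\<epsilon> \<noteq> 0" for \<epsilon> :: real
  proof -
    have "integrable uniform01 (\<lambda>y. \<epsilon> * (v y - J y))" using vi Ji by auto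
    moreover have "(\<integral>y. \<epsilon> * (v y - J y) \<partial>uniform01) = 0" using vi Ji by (simp add: 3)
    moreover have "AE y in uniform01. 0 \<le> \<epsilon> * (v y - J y)" using nest by (intro AE_I2) auto
    ultimately have "AE y in uniform01. \<epsilon> * (v y - J y) = 0"
      using integral_nonneg_eq_0_iff_AE by blast
    then show ?thesis using that by simp
  qed
  \<comment> \<open>Two up-sets of an interval are nested: points violating both inclusions would
    contradict the monotonicity of \<open>v\<close> or of \<open>J\<close>, depending on their
    order.\<close>
  have "(\<forall>y\<in>{0<..<1}. v y \<le> J y) \<or> (\<forall>y\<in>{0<..<1}. J y \<le> v y)"
  proof (rule ccontr)
    assume "\<not> ?thesis"
    then obtain x z where xz: "x \<in> {0<..<1}" "z \<in> {0<..<1}" "J x < v x" "v z < J z" by force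
    then have "v x = 1" "J x = 0" "v z = 0" "J z = 1"
      using v01[of x] v01[of z] J01[of x] J01[of z] by auto
    then show False
      using mono_onD[OF nondec_LpD(1)[OF v], of x z] mono_onD[OF nondec_LpD(1)[OF J], of z x] xz by linarith
  qed
  then have "AE y in uniform01. v y = J y"
  proof
    assume "\<forall>y\<in>{0<..<1}. v y \<le> J y"
    then show ?thesis using AE[of "- 1"] by simp
  next
    assume "\<forall>y\<in>{0<..<1}. J y \<le> v y"
    then show ?thesis using AE[of 1] by simp
  qed
  then show ?thesis
    using right_continuous01_AE_eq[OF nondec_LpD(2)[OF v] nondec_LpD(2)[OF J]] y by (simp add: v_def)
qed

lemma lin_sum:
  assumes "finite S" "\<And>k. k \<in> S \<Longrightarrow> g k \<in> nondec_Lp p" "y \<in> {0<..<1}"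
  shows "lin (\<lambda>y. \<Sum>k\<in>S. g k y) y = (\<Sum>k\<in>S. lin (g k) y)"
  using assms
proof (induction S rule: finite_induct)
  case (insert k S)
  then show ?case
    using lin_add[of "g k" "\<lambda>y. \<Sum>k\<in>S. g k y" y] nondec_Lp_sum[OF p_ge_0, of S g] by simp
qed simp

lemma lin_step_approx:
  assumes f: "f \<in> nondec_Lp p" and y: "y \<in> {0<..<1}"
  shows "lin (\<lambda>y. step_approx n (f y)) y = step_approx n (f y)"
proof -
  have level: "(\<lambda>y. (1 / n) * of_bool (c \<le> f y)) \<in> nondec_Lp p" for c
    by (intro nondec_Lp_intros nondec_Lp_superlevel f) auto
  have lin_level: "lin (\<lambda>y. (1 / n) * of_bool (c \<le> f y)) y = (1 / n) * of_bool (c \<le> f y)" for c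
    using lin_scale[OF nondec_Lp_superlevel[OF f, of c], of "1 / n" y]
      lin_zero_one_valued[OF nondec_Lp_superlevel[OF f, of c] _ y] y by auto
  have sum: "(\<lambda>y. \<Sum>k\<in>{1..2 * n^2}. (1 / n) * of_bool (k / n - n \<le> f y)) \<in> nondec_Lp p"
    by (intro nondec_Lp_sum p_ge_0 level finite_atLeastAtMost)
  have "lin (\<lambda>y. step_approx n (f y)) y =
      lin (\<lambda>y. \<Sum>k\<in>{1..2 * n^2}. (1 / n) * of_bool (k / n - n \<le> f y)) y + lin (\<lambda>_. - real n) y"
    unfolding step_approx_def by (rule lin_add[OF sum nondec_Lp_const y])
  then show ?thesis
    by (simp only: lin_sum[OF finite_atLeastAtMost level y] lin_level lin_const[OF y] step_approx_def)
qed

text \<open>The step approximants are fixed, so their distance to \<open>lin f\<close> equals their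
  distance to \<open>f\<close>. Both errors in the comparison of \<open>lin f\<close> with
  \<open>f\<close> are therefore the same \<open>e n\<close>, which tends to 0.\<close>

lemma lin_eq:
  assumes f: "f \<in> nondec_Lp p" and y: "y \<in> {0<..<1}"
  shows "lin f y = f y"
proof -
  define e where "e n = powint p (\<lambda>y. step_approx n (f y) - f y)" for n
  have s: "(\<lambda>y. step_approx n (f y)) \<in> nondec_Lp p" for n
    by (rule nondec_Lp_step_approx[OF p_ge_0 f])
  have "powint p (\<lambda>y. lin f y - f y) \<le> 2 powr p * (e n + e n)" for n
  proof -
    have i: "integrable uniform01 (\<lambda>y. \<bar>lin f y - step_approx n (f y)\<bar> powr p)"
        "integrable uniform01 (\<lambda>y. \<bar>step_approx n (f y) - f y\<bar> powr p)"
      using s lin_nondec f by (auto intro!: nondec_Lp_integrable_diff[OF p_ge_0])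
    have "powint p (\<lambda>y. lin f y - f y) \<le>
      (\<integral>y. 2 powr p * (\<bar>lin f y - step_approx n (f y)\<bar> powr p + \<bar>step_approx n (f y) - f y\<bar> powr p) \<partial>uniform01)"
      unfolding powint_def
    proof (rule integral_mono)
      show "integrable uniform01 (\<lambda>y. \<bar>lin f y - f y\<bar> powr p)"
        using lin_nondec f by (auto intro!: nondec_Lp_integrable_diff[OF p_ge_0])
      show "\<bar>lin f y - f y\<bar> powr p \<le> 2 powr p * (\<bar>lin f y - step_approx n (f y)\<bar> powr p + \<bar>step_approx n (f y) - f y\<bar> powr p)" for y
        using abs_powr_add_le[OF p_ge_0, of "lin f y - step_approx n (f y)" "step_approx n (f y) - f y"] by simp
    qed (use i in auto)
    also have "\<dots> = 2 powr p * (powint p (\<lambda>y. lin f y - step_approx n (f y)) + e n)"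
      using i by (simp add: powint_def e_def)
    also have "powint p (\<lambda>y. lin f y - step_approx n (f y)) = powint p (\<lambda>y. lin f y - lin (\<lambda>y. step_approx n (f y)) y)"
      by (intro powint_cong) (simp add: lin_step_approx[OF f])
    also have "\<dots> = powint p (\<lambda>y. f y - step_approx n (f y))"
      by (rule powint_lin_diff[OF f s])
    also have "\<dots> = e n"
      unfolding e_def by (intro powint_cong) auto
    finally show ?thesis .
  qed
  moreover have "(\<lambda>n. 2 powr p * (e n + e n)) \<longlonglongrightarrow> 2 powr p * (0 + 0)"
    unfolding e_def using p_gt_1 f by (intro tendsto_intros step_approx_tendsto) auto
  ultimately have "powint p (\<lambda>y. lin f y - f y) \<le> 0"
    by (intro LIMSEQ_le_const[where X = "\<lambda>n. 2 powr p * (e n + e n)"]) auto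
  then have "powint p (\<lambda>y. lin f y - f y) = 0"
    using powint_nonneg[of p] by (intro antisym)
  then show ?thesis
    by (rule powint_diff_eq_0D[OF p_ge_0 lin_nondec[OF f] f _ y])
qed

end

section \<open>The quantile isometry\<close>

lemma Wp_real_distribution: "\<mu> \<in> Wp p \<Longrightarrow> real_distribution \<mu>"
  by (simp add: Wp_def)

lemma distr_uniform01_quantile: "\<mu> \<in> Wp p \<Longrightarrow> distr uniform01 borel (quantile \<mu>) = \<mu>"
  by (simp add: real_distribution.distr_quantile Wp_real_distribution)

lemma quantile_in_nondec_Lp:
  assumes "\<mu> \<in> Wp p"
  shows "quantile \<mu> \<in> nondec_Lp p"
proof -
  note r = Wp_real_distribution[OF assms]
  have [measurable]: "quantile \<mu> \<in> borel_measurable uniform01"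
    by (rule measurable_uniform01_mono_on[OF real_distribution.mono_on_quantile[OF r]])
  have "integrable (distr uniform01 borel (quantile \<mu>)) (\<lambda>x. \<bar>x\<bar> powr p)"
    using assms unfolding distr_uniform01_quantile[OF assms] by (simp add: Wp_def)
  then show ?thesis
    using real_distribution.mono_on_quantile[OF r] real_distribution.right_continuous01_quantile[OF r]
    by (simp add: nondec_Lp_def integrable_distr_eq)
qed

lemma distr_in_Wp: "f \<in> nondec_Lp p \<Longrightarrow> distr uniform01 borel f \<in> Wp p"
  using nondec_LpD[of f p] by (simp add: Wp_def real_distribution_distr_uniform01 integrable_distr_eq)

lemma quantile_distr_nondec_Lp: "f \<in> nondec_Lp p \<Longrightarrow> y \<in> {0<..<1} \<Longrightarrow> quantile (distr uniform01 borel f) y = f y"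
  using nondec_LpD[of f p] quantile_distr_uniform01 by blast

lemma Wp_eqI:
  assumes "\<mu> \<in> Wp p" "\<nu> \<in> Wp p" "\<And>y. y \<in> {0<..<1} \<Longrightarrow> quantile \<mu> y = quantile \<nu> y"
  shows "\<mu> = \<nu>"
proof -
  have "distr uniform01 borel (quantile \<mu>) = distr uniform01 borel (quantile \<nu>)"
    using assms(3) by (intro distr_cong) auto
  then show ?thesis using assms by (simp add: distr_uniform01_quantile)
qed

lemma quantile_AE_eqD:
  assumes "\<mu> \<in> Wp p" "right_continuous01 g" "AE y in uniform01. quantile \<mu> y = g y" "y \<in> {0<..<1}"
  shows "quantile \<mu> y = g y"
  using right_continuous01_AE_eq[OF nondec_LpD(2)[OF quantile_in_nondec_Lp[OF assms(1)]]] assms by blast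

lemma dW_eq_powint:
  assumes "1 < p" "\<mu> \<in> Wp p" "\<nu> \<in> Wp p"
  shows "dW p \<mu> \<nu> = powint p (\<lambda>y. quantile \<mu> y - quantile \<nu> y) powr (1 / p)"
  using dW_distr_uniform01[OF assms(1), of "quantile \<mu>" "quantile \<nu>"] assms nondec_LpD(1)[OF quantile_in_nondec_Lp]
  by (simp add: distr_uniform01_quantile powint_def)

lemma dW_eq_iff:
  assumes "1 < p" "\<mu> \<in> Wp p" "\<nu> \<in> Wp p" "\<mu>' \<in> Wp p" "\<nu>' \<in> Wp p"
  shows "dW p \<mu> \<nu> = dW p \<mu>' \<nu>' \<longleftrightarrow>
    powint p (\<lambda>y. quantile \<mu> y - quantile \<nu> y) = powint p (\<lambda>y. quantile \<mu>' y - quantile \<nu>' y)"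
proof -
  have "(a powr (1 / p) = b powr (1 / p)) = (a = b)" if "0 \<le> a" "0 \<le> b" for a b :: real
  proof
    assume "a powr (1 / p) = b powr (1 / p)"
    then have "(a powr (1 / p)) powr p = (b powr (1 / p)) powr p" by simp
    then show "a = b" using that assms(1) by (simp add: powr_powr)
  qed simp
  then show ?thesis using assms by (simp add: dW_eq_powint powint_nonneg)
qed

lemma dW_self: "1 < p \<Longrightarrow> \<mu> \<in> Wp p \<Longrightarrow> dW p \<mu> \<mu> = 0"
  by (simp add: dW_eq_powint)

lemma dW_eq_0D:
  assumes "1 < p" "\<mu> \<in> Wp p" "\<nu> \<in> Wp p" "dW p \<mu> \<nu> = 0"
  shows "\<mu> = \<nu>"
proof (rule Wp_eqI[OF assms(2,3)])
  have "powint p (\<lambda>y. quantile \<mu> y - quantile \<nu> y) = 0"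
    using assms dW_eq_powint[OF assms(1-3)] by simp
  then show "quantile \<mu> y = quantile \<nu> y" if "y \<in> {0<..<1}" for y
    using powint_diff_eq_0D[OF _ quantile_in_nondec_Lp[OF assms(2)] quantile_in_nondec_Lp[OF assms(3)] _ that] assms(1)
    by simp
qed

section \<open>Push-forward by affine maps and reflection of ranks\<close>

lemma distr_uniform01_reflect: "distr uniform01 uniform01 (\<lambda>y. 1 - y) = uniform01"
proof (rule measure_eqI)
  have meas[measurable]: "(\<lambda>y. 1 - y) \<in> uniform01 \<rightarrow>\<^sub>M uniform01"
    unfolding measurable_cong_sets[OF sets_uniform01 sets_uniform01]
    by (intro measurable_restrict_space3) auto
  fix A assume "A \<in> sets (distr uniform01 uniform01 (\<lambda>y. 1 - y))"
  then have A: "A \<in> sets uniform01" by simp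
  then have A': "A \<in> sets borel" "A \<subseteq> {0<..<1}"
    by (auto simp: sets_uniform01 sets_restrict_space_iff)
  have "emeasure (distr uniform01 uniform01 (\<lambda>y. 1 - y)) A = emeasure uniform01 ((\<lambda>y. 1 - y) -` A \<inter> {0<..<1})"
    using A by (simp add: emeasure_distr)
  also have "(\<lambda>y. 1 - y) -` A \<inter> {0<..<1} = (\<lambda>y. 1 - y) -` A" using A' by auto
  also have "emeasure uniform01 ((\<lambda>y. 1 - y) -` A) = emeasure lborel ((\<lambda>y. 1 - y) -` A)"
    unfolding uniform01_def using A' by (intro emeasure_restrict_space) auto
  also have "\<dots> = emeasure (distr lborel borel (\<lambda>y. 1 + (-1) * y)) A"
    using A' by (subst emeasure_distr) auto
  also have "\<dots> = emeasure lborel A"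
    using lborel_real_affine[of "-1" 1] A' by (simp add: density_1)
  also have "\<dots> = emeasure uniform01 A"
    unfolding uniform01_def using A' by (intro emeasure_restrict_space[symmetric]) auto
  finally show "emeasure (distr uniform01 uniform01 (\<lambda>y. 1 - y)) A = emeasure uniform01 A" .
qed simp

text \<open>The action on ranks of an affine map with slope \<open>\<epsilon>\<close>: a decreasing
  map reverses the order of mass. It is used for slopes 1 and -1, every value other than 1 counting
  as a reflection.\<close>

definition orient :: "real \<Rightarrow> real \<Rightarrow> real" where
  "orient \<epsilon> y = (if \<epsilon> = 1 then y else 1 - y)"

lemma measurable_orient [measurable]: "orient \<epsilon> \<in> uniform01 \<rightarrow>\<^sub>M uniform01"
  unfolding measurable_cong_sets[OF sets_uniform01 sets_uniform01] orient_def
  by (intro measurable_restrict_space3) auto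

lemma distr_uniform01_orient: "distr uniform01 uniform01 (orient \<epsilon>) = uniform01"
proof (cases "\<epsilon> = 1")
  case True
  then show ?thesis by (simp add: orient_def[abs_def] distr_id[unfolded id_def])
next
  case False
  then show ?thesis using distr_uniform01_reflect by (simp add: orient_def[abs_def])
qed

lemma powint_orient:
  assumes "f \<in> borel_measurable uniform01"
  shows "powint p (\<lambda>y. f (orient \<epsilon> y)) = powint p f"
proof -
  have "powint p f = (\<integral>y. \<bar>f y\<bar> powr p \<partial>distr uniform01 uniform01 (orient \<epsilon>))"
    by (simp add: distr_uniform01_orient powint_def)
  also have "\<dots> = powint p (\<lambda>y. f (orient \<epsilon> y))"
    unfolding powint_def using assms by (intro integral_distr) auto
  finally show ?thesis by simp
qed

lemma distr_affine_in_Wp: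
  assumes "0 \<le> p" and \<epsilon>: "\<epsilon> \<in> {1, -1}" and \<mu>: "\<mu> \<in> Wp p"
  shows "distr \<mu> borel (\<lambda>x. \<epsilon> * x + c) \<in> Wp p"
proof -
  interpret real_distribution \<mu> by (rule Wp_real_distribution[OF \<mu>])
  have [measurable]: "(\<lambda>x. \<epsilon> * x + c) \<in> borel_measurable \<mu>" "(\<lambda>x. \<epsilon> * x) \<in> borel_measurable \<mu>"
    by (simp_all add: borel_measurable_continuous_onI[of "\<lambda>x. x"] measurable_cong_sets[OF events_eq_borel refl])
  have "integrable \<mu> (\<lambda>x. \<bar>\<epsilon> * x\<bar> powr p)"
    using \<mu> \<epsilon> by (auto simp: Wp_def abs_mult)
  then have "integrable \<mu> (\<lambda>x. \<bar>\<epsilon> * x + c\<bar> powr p)"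
    using assms(1) by (intro integrable_powr_add) auto
  then show ?thesis
    by (auto simp: Wp_def integrable_distr_eq real_distribution_def real_distribution_axioms_def intro!: prob_space_distr)
qed

text \<open>Both sides are nondecreasing with the same law. For slope -1 the right side is left
  continuous, so at jumps the two may differ and only equality almost everywhere can be
  claimed.\<close>

lemma quantile_distr_affine_AE:
  assumes \<epsilon>: "\<epsilon> \<in> {1, -1}" and \<mu>: "\<mu> \<in> Wp p"
  shows "AE y in uniform01. quantile (distr \<mu> borel (\<lambda>x. \<epsilon> * x + c)) y = \<epsilon> * quantile \<mu> (orient \<epsilon> y) + c"
proof -
  interpret \<mu>: real_distribution \<mu> by (rule Wp_real_distribution[OF \<mu>])
  note q = nondec_LpD[OF quantile_in_nondec_Lp[OF \<mu>]]
  note [measurable] = q(4)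
  have aff: "(\<lambda>x. \<epsilon> * x + c) \<in> borel_measurable borel" by simp
  have D: "real_distribution (distr \<mu> borel (\<lambda>x. \<epsilon> * x + c))"
    by (auto simp: real_distribution_def real_distribution_axioms_def intro!: \<mu>.prob_space_distr)
  show ?thesis
  proof (rule mono_on_distr_eq_imp_AE_eq)
    show "mono_on {0<..<1} (quantile (distr \<mu> borel (\<lambda>x. \<epsilon> * x + c)))"
      by (rule real_distribution.mono_on_quantile[OF D])
    show "mono_on {0<..<1} (\<lambda>y. \<epsilon> * quantile \<mu> (orient \<epsilon> y) + c)"
      using \<epsilon> by (auto intro!: mono_onI mono_onD[OF q(1)] simp: orient_def)
    have "distr uniform01 borel (\<lambda>y. \<epsilon> * quantile \<mu> (orient \<epsilon> y) + c)
      = distr (distr (distr uniform01 uniform01 (orient \<epsilon>)) borel (quantile \<mu>)) borel (\<lambda>x. \<epsilon> * x + c)"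
      by (simp add: distr_distr comp_def)
    also have "\<dots> = distr \<mu> borel (\<lambda>x. \<epsilon> * x + c)"
      by (simp add: distr_uniform01_orient \<mu>.distr_quantile)
    also have "\<dots> = distr uniform01 borel (quantile (distr \<mu> borel (\<lambda>x. \<epsilon> * x + c)))"
      by (simp add: real_distribution.distr_quantile[OF D])
    finally show "distr uniform01 borel (quantile (distr \<mu> borel (\<lambda>x. \<epsilon> * x + c))) =
      distr uniform01 borel (\<lambda>y. \<epsilon> * quantile \<mu> (orient \<epsilon> y) + c)" by simp
  qed
qed

lemma quantile_distr_shift:
  assumes p: "0 \<le> p" and \<mu>: "\<mu> \<in> Wp p" and y: "y \<in> {0<..<1}"
  shows "quantile (distr \<mu> borel (\<lambda>x. x + c)) y = quantile \<mu> y + c"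
proof (rule quantile_AE_eqD[OF _ _ _ y])
  show "distr \<mu> borel (\<lambda>x. x + c) \<in> Wp p"
    using distr_affine_in_Wp[of p 1 \<mu> c] p \<mu> by simp
  show "right_continuous01 (\<lambda>y. quantile \<mu> y + c)"
    by (intro right_continuous01_add nondec_LpD(2)[OF quantile_in_nondec_Lp[OF \<mu>]] right_continuous01_const)
  show "AE y in uniform01. quantile (distr \<mu> borel (\<lambda>x. x + c)) y = quantile \<mu> y + c"
    using quantile_distr_affine_AE[of 1 \<mu> p c] \<mu> by (simp add: orient_def)
qed

lemma dW_distr_affine:
  assumes p: "1 < p" and \<epsilon>: "\<epsilon> \<in> {1, -1}" and \<mu>: "\<mu> \<in> Wp p" and \<nu>: "\<nu> \<in> Wp p"
  shows "dW p (distr \<mu> borel (\<lambda>x. \<epsilon> * x + c)) (distr \<nu> borel (\<lambda>x. \<epsilon> * x + c)) = dW p \<mu> \<nu>"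
proof -
  let ?T = "\<lambda>\<mu>. distr \<mu> borel (\<lambda>x. \<epsilon> * x + c)"
  have T: "?T \<mu> \<in> Wp p" "?T \<nu> \<in> Wp p"
    using distr_affine_in_Wp p \<epsilon> \<mu> \<nu> by auto
  note m = nondec_LpD(4)[OF quantile_in_nondec_Lp]
  note [measurable] = m[OF \<mu>] m[OF \<nu>] m[OF T(1)] m[OF T(2)]
  have "powint p (\<lambda>y. quantile (?T \<mu>) y - quantile (?T \<nu>) y) =
      powint p (\<lambda>y. \<epsilon> * (quantile \<mu> (orient \<epsilon> y) - quantile \<nu> (orient \<epsilon> y)))"
    unfolding powint_def
  proof (rule integral_cong_AE)
    show "AE y in uniform01. \<bar>quantile (?T \<mu>) y - quantile (?T \<nu>) y\<bar> powr p =
        \<bar>\<epsilon> * (quantile \<mu> (orient \<epsilon> y) - quantile \<nu> (orient \<epsilon> y))\<bar> powr p"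
      using quantile_distr_affine_AE[OF \<epsilon> \<mu>, of c] quantile_distr_affine_AE[OF \<epsilon> \<nu>, of c]
      by eventually_elim (simp add: algebra_simps)
  qed measurable
  also have "\<dots> = powint p (\<lambda>y. quantile \<mu> y - quantile \<nu> y)"
    using \<epsilon> powint_orient[of "\<lambda>y. quantile \<mu> y - quantile \<nu> y" p \<epsilon>] by (auto simp: powint_scale)
  finally show ?thesis
    using p T \<mu> \<nu> by (simp add: dW_eq_iff)
qed

section \<open>Isometric embeddings of the Wasserstein space\<close>

lemma isometric_embeddingD:
  assumes "isometric_embedding X d f"
  shows "x \<in> X \<Longrightarrow> f x \<in> X" "x \<in> X \<Longrightarrow> y \<in> X \<Longrightarrow> d (f x) (f y) = d x y"
  using assms by (auto simp: isometric_embedding_def)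

definition quantile_map :: "(real measure \<Rightarrow> real measure) \<Rightarrow> (real \<Rightarrow> real) \<Rightarrow> real \<Rightarrow> real" where
  "quantile_map \<phi> f = quantile (\<phi> (distr uniform01 borel f))"

lemma isometric_self_map_quantile_map:
  assumes p: "1 < p" and \<phi>: "isometric_embedding (Wp p) (dW p) \<phi>"
  shows "isometric_self_map p (quantile_map \<phi>)"
proof
  note D = isometric_embeddingD[OF \<phi>]
  fix f g assume f: "f \<in> nondec_Lp p" and g: "g \<in> nondec_Lp p"
  note W = distr_in_Wp[OF f] distr_in_Wp[OF g]
  have "powint p (\<lambda>y. quantile_map \<phi> f y - quantile_map \<phi> g y) =
      powint p (\<lambda>y. quantile (distr uniform01 borel f) y - quantile (distr uniform01 borel g) y)"
    using dW_eq_iff[OF p D(1)[OF W(1)] D(1)[OF W(2)] W] D(2)[OF W] by (simp add: quantile_map_def)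
  also have "\<dots> = powint p (\<lambda>y. f y - g y)"
    by (intro powint_cong) (simp add: quantile_distr_nondec_Lp[OF f] quantile_distr_nondec_Lp[OF g])
  finally show "powint p (\<lambda>y. quantile_map \<phi> f y - quantile_map \<phi> g y) = powint p (\<lambda>y. f y - g y)" .
qed (use p isometric_embeddingD(1)[OF \<phi>] distr_in_Wp quantile_in_nondec_Lp in \<open>auto simp: quantile_map_def\<close>)

lemma quantile_map_quantile: "\<mu> \<in> Wp p \<Longrightarrow> quantile_map \<phi> (quantile \<mu>) = quantile (\<phi> \<mu>)"
  by (simp add: quantile_map_def distr_uniform01_quantile)

lemma embedding_eq_translation:
  assumes p: "1 < p" "p \<noteq> 2" and \<phi>: "isometric_embedding (Wp p) (dW p) \<phi>"
    and one: "\<And>y. y \<in> {0<..<1} \<Longrightarrow> isometric_self_map.lin (quantile_map \<phi>) (\<lambda>_. 1) y = 1"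
  shows "\<exists>\<nu>\<in>Wp p. \<forall>\<mu>\<in>Wp p. \<forall>y\<in>{0<..<1}. quantile (\<phi> \<mu>) y = quantile \<mu> y + quantile \<nu> y"
proof (intro bexI ballI)
  interpret isometric_self_map p "quantile_map \<phi>"
    by (rule isometric_self_map_quantile_map[OF p(1) \<phi>])
  interpret orientation_preserving p "quantile_map \<phi>"
    using p(2) one by unfold_locales
  \<comment> \<open>The image of the Dirac measure at 0, whose quantile function is the part
    subtracted in \<open>lin\<close>.\<close>
  let ?\<nu> = "\<phi> (distr uniform01 borel (\<lambda>_. 0))"
  show "?\<nu> \<in> Wp p"
    by (intro isometric_embeddingD(1)[OF \<phi>] distr_in_Wp nondec_Lp_const)
  fix \<mu> y assume \<mu>: "\<mu> \<in> Wp p" and y: "y \<in> {0<..<(1::real)}"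
  have "lin (quantile \<mu>) y = quantile \<mu> y"
    by (rule lin_eq[OF quantile_in_nondec_Lp[OF \<mu>] y])
  then show "quantile (\<phi> \<mu>) y = quantile \<mu> y + quantile ?\<nu> y"
    by (simp add: lin_def quantile_map_quantile[OF \<mu>]) (simp add: quantile_map_def)
qed

text \<open>When 1 is sent to -1, \<open>\<phi>\<close> is followed by the reflection
  \<open>R\<close> of the line. The composite adds the quantile of a fixed \<open>\<nu>\<close>;
  since \<open>R\<close> is an involution and acts additively on quantiles, applying it again makes
  \<open>\<phi>\<close> add the quantile of \<open>R \<nu>\<close> to that of
  \<open>R \<mu>\<close>.\<close>

lemma embedding_classification:
  assumes p: "1 < p" "p \<noteq> 2" and \<phi>: "isometric_embedding (Wp p) (dW p) \<phi>"
  shows "\<exists>\<epsilon>\<in>{1, -1}. \<exists>\<nu>\<in>Wp p. \<forall>\<mu>\<in>Wp p. \<forall>y\<in>{0<..<1}.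
    quantile (\<phi> \<mu>) y = quantile (distr \<mu> borel (\<lambda>x. \<epsilon> * x)) y + quantile \<nu> y"
proof -
  interpret isometric_self_map p "quantile_map \<phi>"
    by (rule isometric_self_map_quantile_map[OF p(1) \<phi>])
  obtain \<sigma> where \<sigma>: "\<sigma> \<in> {1, -1}" "\<And>y. y \<in> {0<..<1} \<Longrightarrow> lin (\<lambda>_. 1) y = \<sigma>"
    using lin_one by blast
  show ?thesis
  proof (cases "\<sigma> = 1")
    case True
    have id: "distr \<mu> borel (\<lambda>x. 1 * x) = \<mu>" if "\<mu> \<in> Wp p" for \<mu>
      using real_distribution.events_eq_borel[OF Wp_real_distribution[OF that]]
      by (simp add: distr_id2)
    show ?thesis
      using embedding_eq_translation[OF p \<phi>] \<sigma> True id by (intro bexI[of _ 1]) auto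
  next
    case False
    \<comment> \<open>The shape \<open>- 1 * x + 0\<close> matches the lemmas on affine
      push-forwards.\<close>
    define R where "R \<mu> = distr \<mu> borel (\<lambda>x. - 1 * x + 0)" for \<mu> :: "real measure"
    have R_Wp: "R \<mu> \<in> Wp p" if "\<mu> \<in> Wp p" for \<mu>
      unfolding R_def using that p(1) by (intro distr_affine_in_Wp) auto
    have R_dW: "dW p (R \<mu>) (R \<nu>) = dW p \<mu> \<nu>" if "\<mu> \<in> Wp p" "\<nu> \<in> Wp p" for \<mu> \<nu>
      unfolding R_def using that p(1) by (intro dW_distr_affine) auto
    have R_AE: "AE y in uniform01. quantile (R \<mu>) y = - quantile \<mu> (1 - y)" if "\<mu> \<in> Wp p" for \<mu>
      using quantile_distr_affine_AE[of "- 1" \<mu> p 0] that by (simp add: R_def orient_def)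
    have R_R: "R (R \<mu>) = \<mu>" if "\<mu> \<in> Wp p" for \<mu>
    proof -
      have m: "sets \<mu> = sets borel"
        using real_distribution.events_eq_borel[OF Wp_real_distribution[OF that]] .
      then show ?thesis
        by (simp add: R_def distr_distr comp_def measurable_cong_sets[OF m refl] distr_id2)
    qed
    define \<phi>' where "\<phi>' \<mu> = R (\<phi> \<mu>)" for \<mu>
    have \<phi>'_emb: "isometric_embedding (Wp p) (dW p) \<phi>'"
      using \<phi> R_Wp R_dW by (auto simp: isometric_embedding_def \<phi>'_def Pi_iff)
    interpret F: isometric_self_map p "quantile_map \<phi>'"
      by (rule isometric_self_map_quantile_map[OF p(1) \<phi>'_emb])
    note W = isometric_embeddingD(1)[OF \<phi> distr_in_Wp[OF nondec_Lp_const]]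
    \<comment> \<open>Almost everywhere the linear part of \<open>\<phi>'\<close> at
      \<open>y\<close> is minus that of \<open>\<phi>\<close> at \<open>1 - y\<close>, and the
      latter is -1 on constants 1.\<close>
    have "F.lin (\<lambda>_. 1) y = 1" if "y \<in> {0<..<1}" for y
    proof (rule right_continuous01_AE_eq[OF nondec_LpD(2)[OF F.lin_nondec[OF nondec_Lp_const]] right_continuous01_const _ that])
      have "AE y in uniform01. y \<in> {0<..<1}" by (rule AE_I2) simp
      then show "AE y in uniform01. F.lin (\<lambda>_. 1) y = 1"
        using R_AE[OF W[of 1]] R_AE[OF W[of 0]]
      proof eventually_elim
        case (elim y)
        have "lin (\<lambda>_. 1) (1 - y) = - 1" using \<sigma> False elim by auto
        with elim show ?case
          by (simp add: F.lin_def lin_def quantile_map_def \<phi>'_def)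
      qed
    qed
    then obtain \<nu> where \<nu>: "\<nu> \<in> Wp p"
      and eq: "\<And>\<mu> y. \<mu> \<in> Wp p \<Longrightarrow> y \<in> {0<..<1} \<Longrightarrow> quantile (\<phi>' \<mu>) y = quantile \<mu> y + quantile \<nu> y"
      using embedding_eq_translation[OF p \<phi>'_emb] by auto
    have "quantile (\<phi> \<mu>) y = quantile (R \<mu>) y + quantile (R \<nu>) y" if \<mu>: "\<mu> \<in> Wp p" and y: "y \<in> {0<..<1}" for \<mu> y
    proof (rule quantile_AE_eqD[OF _ _ _ y])
      note \<phi>W = isometric_embeddingD(1)[OF \<phi> \<mu>]
      show "\<phi> \<mu> \<in> Wp p" by fact
      show "right_continuous01 (\<lambda>y. quantile (R \<mu>) y + quantile (R \<nu>) y)"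
        by (intro right_continuous01_add nondec_LpD(2)[OF quantile_in_nondec_Lp[OF R_Wp[OF \<mu>]]]
          nondec_LpD(2)[OF quantile_in_nondec_Lp[OF R_Wp[OF \<nu>]]])
      have "AE y in uniform01. quantile (R (\<phi>' \<mu>)) y = - quantile (\<phi>' \<mu>) (1 - y)"
        using R_AE[OF R_Wp[OF \<phi>W]] by (simp add: \<phi>'_def)
      moreover have "AE y in uniform01. y \<in> {0<..<1}" by (rule AE_I2) simp
      ultimately show "AE y in uniform01. quantile (\<phi> \<mu>) y = quantile (R \<mu>) y + quantile (R \<nu>) y"
        using R_AE[OF \<mu>] R_AE[OF \<nu>]
      proof eventually_elim
        case (elim y)
        have "R (\<phi>' \<mu>) = \<phi> \<mu>" using R_R[OF \<phi>W] by (simp add: \<phi>'_def)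
        with elim eq[OF \<mu>, of "1 - y"] show ?case by simp
      qed
    qed
    then show ?thesis
      using R_Wp[OF \<nu>] by (intro bexI[of _ "- 1"] bexI[of _ "R \<nu>"]) (auto simp: R_def)
  qed
qed

section \<open>Isometry groups and the push-forward homomorphism\<close>

lemma Isom_real_iff: "\<psi> \<in> Isom (UNIV :: real set) dist \<longleftrightarrow> (\<exists>\<epsilon>\<in>{1, -1}. \<exists>c. \<psi> = (\<lambda>x. \<epsilon> * x + c))"
proof
  assume "\<psi> \<in> Isom (UNIV :: real set) dist"
  then have d: "\<bar>\<psi> x - \<psi> y\<bar> = \<bar>x - y\<bar>" for x y
    by (auto simp: Isom_def IsEmb_def isometric_embedding_def dist_real_def)
  define \<epsilon> where "\<epsilon> = \<psi> 1 - \<psi> 0"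
  have \<epsilon>: "\<epsilon> \<in> {1, -1}" using d[of 1 0] by (auto simp: \<epsilon>_def abs_if split: if_splits)
  \<comment> \<open>The distances of \<open>\<psi> x\<close> to \<open>\<psi> 0\<close> and
    \<open>\<psi> 1\<close> leave a single candidate on the line.\<close>
  have "\<psi> x = \<epsilon> * x + \<psi> 0" for x
  proof -
    have "\<psi> 1 = \<psi> 0 + \<epsilon>" by (simp add: \<epsilon>_def)
    then show ?thesis
      using d[of x 0] d[of x 1] \<epsilon> by (elim insertE) (auto simp: abs_if split: if_splits)
  qed
  then show "\<exists>\<epsilon>\<in>{1, -1}. \<exists>c. \<psi> = (\<lambda>x. \<epsilon> * x + c)" using \<epsilon> by blast
next
  assume "\<exists>\<epsilon>\<in>{1, -1}. \<exists>c. \<psi> = (\<lambda>x. \<epsilon> * x + c)"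
  then obtain \<epsilon> c where \<psi>: "\<epsilon> \<in> {1, -1}" "\<psi> = (\<lambda>x. \<epsilon> * x + c)" by blast
  have "\<psi> (\<epsilon> * (y - c)) = y" for y using \<psi> by auto
  then have "surj \<psi>" by (rule surjI)
  then show "\<psi> \<in> Isom (UNIV :: real set) dist"
    using \<psi> by (auto simp: Isom_def IsEmb_def isometric_embedding_def dist_real_def)
qed

lemma Isom_imp_Bij:
  assumes "\<And>x y. x \<in> X \<Longrightarrow> y \<in> X \<Longrightarrow> d x y = 0 \<longleftrightarrow> x = y" and f: "f \<in> Isom X d"
  shows "f \<in> Bij X"
proof -
  have "inj_on f X"
  proof (rule inj_onI)
    fix x y assume xy: "x \<in> X" "y \<in> X" "f x = f y"
    have "f x \<in> X" "f y \<in> X" "d (f x) (f y) = d x y"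
      using f xy(1,2) by (auto simp: Isom_def IsEmb_def isometric_embedding_def)
    then show "x = y" using assms(1)[of x y] assms(1)[of "f x" "f y"] xy by simp
  qed
  then show ?thesis using f by (auto simp: Isom_def IsEmb_def Bij_def bij_betw_def)
qed

lemma group_IsomGroup:
  assumes d: "\<And>x y. x \<in> X \<Longrightarrow> y \<in> X \<Longrightarrow> d x y = 0 \<longleftrightarrow> x = y"
  shows "group (IsomGroup X d)"
proof -
  have bij: "f \<in> Bij X" if "f \<in> Isom X d" for f
    using d that by (rule Isom_imp_Bij)
  interpret group "BijGroup X" by (rule group_BijGroup)
  have "subgroup (Isom X d) (BijGroup X)"
  proof (rule subgroupI)
    show "Isom X d \<subseteq> carrier (BijGroup X)" using bij by (auto simp: BijGroup_def)
    have "(\<lambda>x\<in>X. x) \<in> Isom X d"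
      by (auto simp: Isom_def IsEmb_def isometric_embedding_def)
    then show "Isom X d \<noteq> {}" by auto
  next
    fix f assume f: "f \<in> Isom X d"
    have fX: "f ` X = X" using f by (simp add: Isom_def)
    have "d (inv_into X f x) (inv_into X f y) = d x y" if "x \<in> X" "y \<in> X" for x y
    proof -
      have "inv_into X f x \<in> X" "inv_into X f y \<in> X" using that fX by (auto intro: inv_into_into)
      then have "d (f (inv_into X f x)) (f (inv_into X f y)) = d (inv_into X f x) (inv_into X f y)"
        using f by (auto simp: Isom_def IsEmb_def isometric_embedding_def)
      then show ?thesis using that fX by (simp add: f_inv_into_f)
    qed
    moreover have "(\<lambda>x\<in>X. inv_into X f x) \<in> Bij X"
      by (rule restrict_inv_into_Bij[OF bij[OF f]])
    ultimately have "(\<lambda>x\<in>X. inv_into X f x) \<in> Isom X d"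
      by (auto simp: Isom_def IsEmb_def isometric_embedding_def Bij_def bij_betw_def)
    then show "inv\<^bsub>BijGroup X\<^esub> f \<in> Isom X d" by (simp add: inv_BijGroup[OF bij[OF f]])
  next
    fix f g assume f: "f \<in> Isom X d" and g: "g \<in> Isom X d"
    have "compose X f g \<in> Isom X d"
      using f g by (auto simp: Isom_def IsEmb_def isometric_embedding_def compose_def Pi_iff image_image[symmetric] simp del: image_image)
    then show "f \<otimes>\<^bsub>BijGroup X\<^esub> g \<in> Isom X d" using bij f g by (simp add: BijGroup_def)
  qed
  then show ?thesis unfolding IsomGroup_def by (rule subgroup.subgroup_is_group) (rule group_BijGroup)
qed

lemma push_in_Isom:
  assumes p: "1 < p" and \<psi>: "\<psi> \<in> Isom (UNIV :: real set) dist"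
  shows "push p \<psi> \<in> Isom (Wp p) (dW p)"
proof -
  obtain \<epsilon> c where \<epsilon>: "\<epsilon> \<in> {1, -1}" and \<psi>_eq: "\<psi> = (\<lambda>x. \<epsilon> * x + c)"
    using \<psi> unfolding Isom_real_iff by blast
  have "push p \<psi> \<in> IsEmb (Wp p) (dW p)"
    using distr_affine_in_Wp[OF _ \<epsilon>, of p _ c] dW_distr_affine[OF p \<epsilon>, of _ _ c] p
    by (auto simp: push_def IsEmb_def isometric_embedding_def \<psi>_eq)
  moreover have "Wp p \<subseteq> push p \<psi> ` Wp p"
  proof
    fix \<mu> assume \<mu>: "\<mu> \<in> Wp p"
    \<comment> \<open>The push-forward by the inverse of \<open>\<psi>\<close>, which uses that
      \<open>\<epsilon>\<close> is its own reciprocal.\<close>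
    define \<mu>' where "\<mu>' = distr \<mu> borel (\<lambda>x. \<epsilon> * x + (- \<epsilon> * c))"
    have \<mu>': "\<mu>' \<in> Wp p" unfolding \<mu>'_def using p \<epsilon> \<mu> by (intro distr_affine_in_Wp) auto
    have m: "sets \<mu> = sets borel"
      using real_distribution.events_eq_borel[OF Wp_real_distribution[OF \<mu>]] .
    have "(\<lambda>x. \<epsilon> * (\<epsilon> * x + (- \<epsilon> * c)) + c) = (\<lambda>x. x)" using \<epsilon> by auto
    then have "distr \<mu>' borel \<psi> = \<mu>"
      unfolding \<mu>'_def \<psi>_eq
      by (subst distr_distr) (auto simp: comp_def measurable_cong_sets[OF m refl] distr_id2[OF m[symmetric]])
    then show "\<mu> \<in> push p \<psi> ` Wp p" using \<mu>' by (force simp: push_def)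
  qed
  ultimately show ?thesis by (auto simp: Isom_def IsEmb_def isometric_embedding_def)
qed

lemma push_compose:
  assumes p: "1 < p" and \<psi>: "\<psi> \<in> Isom (UNIV :: real set) dist" and \<eta>: "\<eta> \<in> Isom (UNIV :: real set) dist"
  shows "push p (compose UNIV \<psi> \<eta>) = compose (Wp p) (push p \<psi>) (push p \<eta>)"
proof
  fix \<mu>
  have meas: "\<psi> \<in> borel_measurable borel" "\<eta> \<in> borel_measurable borel"
    using \<psi> \<eta> unfolding Isom_real_iff by auto
  show "push p (compose UNIV \<psi> \<eta>) \<mu> = compose (Wp p) (push p \<psi>) (push p \<eta>) \<mu>"
  proof (cases "\<mu> \<in> Wp p")
    case True
    have m: "sets \<mu> = sets borel"
      using real_distribution.events_eq_borel[OF Wp_real_distribution[OF True]] .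
    have "push p \<eta> \<mu> \<in> Wp p" using push_in_Isom[OF p \<eta>] True by (auto simp: Isom_def)
    then show ?thesis
      using True meas by (simp add: push_def compose_def distr_distr measurable_cong_sets[OF m refl] comp_def restrict_UNIV)
  qed (simp add: push_def compose_def)
qed

lemma dW_eq_0_iff: "1 < p \<Longrightarrow> \<mu> \<in> Wp p \<Longrightarrow> \<nu> \<in> Wp p \<Longrightarrow> dW p \<mu> \<nu> = 0 \<longleftrightarrow> \<mu> = \<nu>"
  using dW_eq_0D dW_self by blast

lemma group_hom_push:
  assumes p: "1 < p"
  shows "group_hom (IsomGroup (UNIV :: real set) dist) (IsomGroup (Wp p) (dW p)) (push p)"
proof (intro group_hom.intro group_hom_axioms.intro group_IsomGroup homI)
  fix \<psi> \<eta> assume "\<psi> \<in> carrier (IsomGroup (UNIV :: real set) dist)" "\<eta> \<in> carrier (IsomGroup (UNIV :: real set) dist)"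
  then have I: "\<psi> \<in> Isom (UNIV :: real set) dist" "\<eta> \<in> Isom (UNIV :: real set) dist" by (auto simp: IsomGroup_def)
  then have "\<psi> \<in> Bij UNIV" "\<eta> \<in> Bij UNIV" using Isom_imp_Bij[of UNIV dist] by auto
  moreover have "push p \<psi> \<in> Bij (Wp p)" "push p \<eta> \<in> Bij (Wp p)"
    using Isom_imp_Bij[of "Wp p" "dW p"] push_in_Isom[OF p] dW_eq_0_iff[OF p] I by blast+
  ultimately show "push p (\<psi> \<otimes>\<^bsub>IsomGroup UNIV dist\<^esub> \<eta>) = push p \<psi> \<otimes>\<^bsub>IsomGroup (Wp p) (dW p)\<^esub> push p \<eta>"
    using push_compose[OF p I] by (simp add: IsomGroup_def BijGroup_def)
qed (use push_in_Isom[OF p] dW_eq_0_iff[OF p] in \<open>auto simp: IsomGroup_def\<close>)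

text \<open>Dirac measures, realised as laws of constant functions, recover \<open>\<psi>\<close>
  point by point; the quantile at the sample rank 1/2 reads off the location.\<close>

lemma inj_on_push: "inj_on (push p) (Isom (UNIV :: real set) dist)"
proof (rule inj_onI, rule ext)
  fix \<psi> \<eta> :: "real \<Rightarrow> real" and x
  assume I: "\<psi> \<in> Isom UNIV dist" "\<eta> \<in> Isom UNIV dist" and eq: "push p \<psi> = push p \<eta>"
  have meas: "\<psi> \<in> borel_measurable borel" "\<eta> \<in> borel_measurable borel"
    using I unfolding Isom_real_iff by auto
  have "distr uniform01 borel (\<lambda>_. x) \<in> Wp p" by (intro distr_in_Wp nondec_Lp_const)
  then have "distr (distr uniform01 borel (\<lambda>_. x)) borel \<psi> = distr (distr uniform01 borel (\<lambda>_. x)) borel \<eta>"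
    using fun_cong[OF eq, of "distr uniform01 borel (\<lambda>_. x)"] by (simp add: push_def)
  then have "distr uniform01 borel (\<lambda>_. \<psi> x) = distr uniform01 borel (\<lambda>_. \<eta> x)"
    using meas by (simp add: distr_distr comp_def distr_return)
  then show "\<psi> x = \<eta> x"
    using quantile_distr_nondec_Lp[OF nondec_Lp_const, of "1/2" "\<psi> x"]
      quantile_distr_nondec_Lp[OF nondec_Lp_const, of "1/2" "\<eta> x"] by simp
qed

text \<open>A preimage of the Dirac measure at 0 yields two nondecreasing quantile functions with
  sum 0, so both are constant. Thus \<open>\<nu>\<close> is a Dirac measure, and its translation is
  a shift of the line that can be absorbed into \<open>\<psi>\<close>.\<close>

lemma surjective_embedding_eq_push:
  assumes p: "1 < p" "p \<noteq> 2" and \<phi>: "isometric_embedding (Wp p) (dW p) \<phi>" and surj: "\<phi> ` Wp p = Wp p"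
  shows "\<exists>\<psi>\<in>Isom (UNIV :: real set) dist. \<forall>\<mu>\<in>Wp p. \<phi> \<mu> = push p \<psi> \<mu>"
proof -
  obtain \<epsilon> \<nu> where \<epsilon>: "\<epsilon> \<in> {1, -1}" and \<nu>: "\<nu> \<in> Wp p"
    and eq: "\<And>\<mu> y. \<mu> \<in> Wp p \<Longrightarrow> y \<in> {0<..<1} \<Longrightarrow>
      quantile (\<phi> \<mu>) y = quantile (distr \<mu> borel (\<lambda>x. \<epsilon> * x)) y + quantile \<nu> y"
    using embedding_classification[OF p \<phi>] by blast
  have E: "distr \<mu> borel (\<lambda>x. \<epsilon> * x) \<in> Wp p" if "\<mu> \<in> Wp p" for \<mu>
    using distr_affine_in_Wp[OF _ \<epsilon> that, of 0] p(1) by simp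
  have "distr uniform01 borel (\<lambda>_. 0) \<in> \<phi> ` Wp p"
    unfolding surj by (intro distr_in_Wp nondec_Lp_const)
  then obtain \<mu>0 where \<mu>0: "\<mu>0 \<in> Wp p" "\<phi> \<mu>0 = distr uniform01 borel (\<lambda>_. 0)" by auto
  have zero: "quantile (distr \<mu>0 borel (\<lambda>x. \<epsilon> * x)) y + quantile \<nu> y = 0" if "y \<in> {0<..<1}" for y
    using eq[OF \<mu>0(1) that] \<mu>0(2) quantile_distr_nondec_Lp[OF nondec_Lp_const that, of 0] by simp
  define c where "c = quantile \<nu> (1/2)"
  have const: "quantile \<nu> y = c" if "y \<in> {0<..<1}" for y
  proof -
    have "quantile \<nu> u = quantile \<nu> v" if "u \<in> {0<..<1}" "v \<in> {0<..<1}" "u \<le> v" for u v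
      using mono_onD[OF nondec_LpD(1)[OF quantile_in_nondec_Lp[OF \<nu>]] that]
        mono_onD[OF nondec_LpD(1)[OF quantile_in_nondec_Lp[OF E[OF \<mu>0(1)]]] that]
        zero[OF that(1)] zero[OF that(2)] by linarith
    from this[of y "1/2"] this[of "1/2" y] that show ?thesis
      unfolding c_def by (cases "y \<le> 1/2") auto
  qed
  define \<psi> where "\<psi> = (\<lambda>x. \<epsilon> * x + c)"
  show ?thesis
  proof (intro bexI ballI)
    show \<psi>: "\<psi> \<in> Isom UNIV dist" unfolding \<psi>_def Isom_real_iff using \<epsilon> by blast
    fix \<mu> assume \<mu>: "\<mu> \<in> Wp p"
    have m: "sets \<mu> = sets borel"
      using real_distribution.events_eq_borel[OF Wp_real_distribution[OF \<mu>]] .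
    have "push p \<psi> \<mu> = distr (distr \<mu> borel (\<lambda>x. \<epsilon> * x)) borel (\<lambda>x. x + c)"
      using \<mu> by (simp add: push_def \<psi>_def distr_distr comp_def measurable_cong_sets[OF m refl])
    moreover have "\<phi> \<mu> = distr (distr \<mu> borel (\<lambda>x. \<epsilon> * x)) borel (\<lambda>x. x + c)"
    proof (rule Wp_eqI)
      show "\<phi> \<mu> \<in> Wp p" by (rule isometric_embeddingD(1)[OF \<phi> \<mu>])
      show "distr (distr \<mu> borel (\<lambda>x. \<epsilon> * x)) borel (\<lambda>x. x + c) \<in> Wp p"
        using distr_affine_in_Wp[of p 1, OF _ _ E[OF \<mu>], of c] p(1) by simp
      fix y :: real assume y: "y \<in> {0<..<1}"
      show "quantile (\<phi> \<mu>) y = quantile (distr (distr \<mu> borel (\<lambda>x. \<epsilon> * x)) borel (\<lambda>x. x + c)) y"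
        using eq[OF \<mu> y] const[OF y] quantile_distr_shift[OF _ E[OF \<mu>] y, of c] p(1) by simp
    qed
    ultimately show "\<phi> \<mu> = push p \<psi> \<mu>" by simp
  qed
qed

text \<open>Translation by the uniform distribution on the unit interval misses the Dirac measures.\<close>
lemma exists_nonsurjective_embedding:
  assumes p: "1 < p"
  shows "\<exists>\<phi>\<in>IsEmb (Wp p) (dW p). \<phi> ` Wp p \<noteq> Wp p"
proof -
  have [measurable]: "(\<lambda>y. y) \<in> borel_measurable uniform01"
    by (rule measurable_uniform01_mono_on) (simp add: mono_on_def)
  have "integrable uniform01 (\<lambda>y. \<bar>y\<bar> powr p)"
  proof (rule uniform01.integrable_const_bound[of _ 1])
    show "AE y in uniform01. norm (\<bar>y\<bar> powr p) \<le> 1"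
      using p by (intro AE_I2) (simp add: powr_le1)
  qed measurable
  then have id: "(\<lambda>y. y) \<in> nondec_Lp p"
    by (simp add: nondec_Lp_def mono_on_def right_continuous01_def)
  have q_id: "(\<lambda>y. quantile \<mu> y + y) \<in> nondec_Lp p" if "\<mu> \<in> Wp p" for \<mu>
    using p id quantile_in_nondec_Lp[OF that] by (intro nondec_Lp_add) auto
  define \<phi> where "\<phi> = (\<lambda>\<mu>\<in>Wp p. distr uniform01 borel (\<lambda>y. quantile \<mu> y + y))"
  have q: "quantile (\<phi> \<mu>) y = quantile \<mu> y + y" if "\<mu> \<in> Wp p" "y \<in> {0<..<1}" for \<mu> y
    using quantile_distr_nondec_Lp[OF q_id that(2)] that by (simp add: \<phi>_def)
  have W: "\<phi> \<mu> \<in> Wp p" if "\<mu> \<in> Wp p" for \<mu>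
    using distr_in_Wp[OF q_id] that by (simp add: \<phi>_def)
  have "dW p (\<phi> \<mu>) (\<phi> \<nu>) = dW p \<mu> \<nu>" if "\<mu> \<in> Wp p" "\<nu> \<in> Wp p" for \<mu> \<nu>
    unfolding dW_eq_iff[OF p W[OF that(1)] W[OF that(2)] that]
    by (intro powint_cong) (simp add: q that)
  then have "\<phi> \<in> IsEmb (Wp p) (dW p)"
    using W by (auto simp: IsEmb_def isometric_embedding_def \<phi>_def)
  moreover have "distr uniform01 borel (\<lambda>_. 0) \<notin> \<phi> ` Wp p"
  proof
    assume "distr uniform01 borel (\<lambda>_. 0) \<in> \<phi> ` Wp p"
    then obtain \<mu> where \<mu>: "\<mu> \<in> Wp p" "\<phi> \<mu> = distr uniform01 borel (\<lambda>_. 0)" by auto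
    \<comment> \<open>A preimage of the Dirac measure at 0 would need a strictly decreasing quantile
      function.\<close>
    have "quantile \<mu> y = - y" if "y \<in> {0<..<1}" for y
      using q[OF \<mu>(1) that] \<mu>(2) quantile_distr_nondec_Lp[OF nondec_Lp_const that, of 0] by simp
    then show False
      using mono_onD[OF nondec_LpD(1)[OF quantile_in_nondec_Lp[OF \<mu>(1)]], of "1/4" "3/4"] by simp
  qed
  moreover have "distr uniform01 borel (\<lambda>_. 0) \<in> Wp p" by (intro distr_in_Wp nondec_Lp_const)
  ultimately show ?thesis by blast
qed

theorem theorem3p16:
  fixes p :: real
  assumes "1 < p" and "p \<noteq> 2"
  shows
    "(\<forall>\<phi>. isometric_embedding (Wp p) (dW p) \<phi> \<longrightarrow>
        (\<exists>\<psi>\<in>Isom (UNIV :: real set) dist. \<exists>\<nu>\<in>Wp p. \<forall>\<mu>\<in>Wp p. \<forall>y\<in>{0<..<1}.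
           quantile (\<phi> \<mu>) y = quantile (push p \<psi> \<mu>) y + quantile \<nu> y) \<and>
        (bij_betw \<phi> (Wp p) (Wp p) \<longrightarrow>
           (\<exists>\<psi>\<in>Isom (UNIV :: real set) dist. \<forall>\<mu>\<in>Wp p. \<phi> \<mu> = push p \<psi> \<mu>))) \<and>
     group_hom (IsomGroup (UNIV :: real set) dist) (IsomGroup (Wp p) (dW p)) (push p) \<and>
     inj_on (push p) (Isom (UNIV :: real set) dist) \<and>
     push p ` Isom (UNIV :: real set) dist = Isom (Wp p) (dW p) \<and>
     Isom (Wp p) (dW p) \<subset> IsEmb (Wp p) (dW p)"
proof (intro conjI allI impI)
  fix \<phi> assume \<phi>: "isometric_embedding (Wp p) (dW p) \<phi>"
  obtain \<epsilon> \<nu> where *: "\<epsilon> \<in> {1, -1}" "\<nu> \<in> Wp p" "\<forall>\<mu>\<in>Wp p. \<forall>y\<in>{0<..<1}.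
      quantile (\<phi> \<mu>) y = quantile (distr \<mu> borel (\<lambda>x. \<epsilon> * x)) y + quantile \<nu> y"
    using embedding_classification[OF assms \<phi>] by blast
  have "(\<lambda>x. \<epsilon> * x + 0) \<in> Isom UNIV dist" unfolding Isom_real_iff using *(1) by blast
  then show "\<exists>\<psi>\<in>Isom (UNIV :: real set) dist. \<exists>\<nu>\<in>Wp p. \<forall>\<mu>\<in>Wp p. \<forall>y\<in>{0<..<1}.
           quantile (\<phi> \<mu>) y = quantile (push p \<psi> \<mu>) y + quantile \<nu> y"
    using * by (intro bexI[of _ "\<lambda>x. \<epsilon> * x + 0"] bexI[of _ \<nu>]) (auto simp: push_def)
  assume "bij_betw \<phi> (Wp p) (Wp p)"
  then show "\<exists>\<psi>\<in>Isom (UNIV :: real set) dist. \<forall>\<mu>\<in>Wp p. \<phi> \<mu> = push p \<psi> \<mu>"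
    using surjective_embedding_eq_push[OF assms \<phi>] by (simp add: bij_betw_def)
next
  show "group_hom (IsomGroup (UNIV :: real set) dist) (IsomGroup (Wp p) (dW p)) (push p)"
    by (rule group_hom_push[OF assms(1)])
  show "inj_on (push p) (Isom (UNIV :: real set) dist)"
    by (rule inj_on_push)
  show "push p ` Isom (UNIV :: real set) dist = Isom (Wp p) (dW p)"
  proof (intro antisym subsetI)
    fix f assume f: "f \<in> Isom (Wp p) (dW p)"
    then obtain \<psi> where \<psi>: "\<psi> \<in> Isom (UNIV :: real set) dist" "\<forall>\<mu>\<in>Wp p. f \<mu> = push p \<psi> \<mu>"
      using surjective_embedding_eq_push[OF assms, of f] by (auto simp: Isom_def IsEmb_def)
    \<comment> \<open>Agreement on \<open>Wp p\<close> is enough because both maps are extensional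
      and share the default value elsewhere.\<close>
    have "f = push p \<psi>"
      using f \<psi>(2) by (intro extensionalityI[of _ "Wp p"]) (auto simp: Isom_def IsEmb_def push_def)
    then show "f \<in> push p ` Isom UNIV dist" using \<psi>(1) by blast
  qed (use push_in_Isom[OF assms(1)] in auto)
  show "Isom (Wp p) (dW p) \<subset> IsEmb (Wp p) (dW p)"
    using exists_nonsurjective_embedding[OF assms(1)] by (auto simp: Isom_def)
qed

end
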